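(* Let $n_L,n_N,n_R\in\mathbb{N}$, $\omega>0$, $s_1,s_2>0$, let $B\in\mathbb{R}^{n_L\times n_N\times n_R}$ and let $S$ be a subset of $\{1,\dots,n_L\}\times\{1,\dots,n_N\}\times\{1,\dots,n_R\}$. Let $A\in\mathbb{R}^{n_L\times n_N\times n_R}$ be a (nonzero) tensor of TT-rank $(r_\gamma,r_\theta)$ with standard representation $(\mathcal{L},\Gamma,\mathcal{N},\Theta,\mathcal{R})$. Then the minimizer $N^+$ of the variational residual function $\widetilde N\mapsto C_{B,S,\mathcal{L},\Gamma\mathcal{N}\Theta,\mathcal{R}}(\widetilde N)$ is given, for $j=1,\dots,n_N$, by $$N^+(j)=\mathrm{argmin}_{\widetilde N(j)}\ \|\mathcal{L}\,\widetilde N(j)\,\mathcal{R}-B(j)\|^2_{S(j)}+\Omega(j),$$ $$\Omega(j)=n_L^{-1}\zeta_1\,\omega^2\,\|\Gamma^{-1}\widetilde N(j)\,\mathcal{R}_{:,S(j)_2}\|_F^2+n_R^{-1}\zeta_2\,\omega^2\,\|\mathcal{L}_{S(j)_1,:}\,\widetilde N(j)\,\Theta^{-1}\|_F^2+|S(j)|(n_Rn_L)^{-1}\zeta_{(1,2)}\,\omega^4\,\|\Gamma^{-1}\widetilde N(j)\,\Theta^{-1}\|_F^2 ,$$ where the constants are, with $\#_{\mathcal{L}}=n_Lr_\gamma$, $\#_{\mathcal{N}}=r_\gamma n_N r_\theta$, $\#_{\mathcal{R}}=r_\theta n_R$ and $D=\#_{\mathcal{L}}+\#_{\mathcal{N}}+\#_{\mathcal{R}}$,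 $$\zeta_1=s_1^2\frac{\#_{\mathcal{L}}}{r_\gamma(D+2)},\qquad \zeta_2=s_2^2\frac{\#_{\mathcal{R}}}{r_\theta(D+2)},\qquad \zeta_{(1,2)}=s_1^2s_2^2\frac{\#_{\mathcal{R}}\#_{\mathcal{L}}}{r_\gamma r_\theta(D+2)(D+4)} .$$
   Context: A core is a family $H=(H(j))_j$ of matrices of equal size; a tensor $A\in\mathbb{R}^{n_L\times n_N\times n_R}$ is identified with the core $A(j)=(A_{i,j,k})_{i,k}\in\mathbb{R}^{n_L\times n_R}$, $j=1,\dots,n_N$. Products of matrices with cores are taken slicewise: $(LNR)(j)=L\,N(j)\,R$. The left unfolding $\mathfrak{L}(H)$ stacks the matrices $H(j)$ below each other, the right unfolding $\mathfrak{R}(H)$ puts them side by side. $\|\cdot\|_F$ is the Frobenius norm, $\|T\|_S^2:=\sum_{s\in S}T_s^2$, $S(j)=\{(i,k)\mid(i,j,k)\in S\}$, $\|T(j)\|^2_{S(j)}=\sum_{(i,k)\in S(j)}T(j)_{i,k}^2$. For an enumeration $S(j)=\{x^{(1)},\dots,x^{(|S(j)|)}\}\subset\mathbb{N}^2$ put $S(j)_u=(x_u^{(1)},x_u^{(2)},\dots)$, $u=1,2$ (tuples, repetitions kept); $\mathcal{R}_{:,S(j)_2}$ is the matrix whose $\ell$-th column is column $x^{(\ell)}_2$ of $\mathcal{R}$, and $\mathcal{L}_{S(j)_1,:}$ the matrix whose $\ell$-th row is row $x^{(\ell)}_1$ of $\mathcal{L}$. The TT-rank of $A$ is $(r_\gamma,r_\theta)=(\mathrm{rank}\,A^{(\{1\})},\mathrm{rank}\,A^{(\{1,2\})})$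 with $A^{(\{1\})}=\mathfrak{R}(A)$, $A^{(\{1,2\})}=\mathfrak{L}(A)$. The standard representation $(\mathcal{L},\Gamma,\mathcal{N},\Theta,\mathcal{R})$ of $A$, with $\mathcal{L}\in\mathbb{R}^{n_L\times r_\gamma}$, $\mathcal{N}(j)\in\mathbb{R}^{r_\gamma\times r_\theta}$, $\mathcal{R}\in\mathbb{R}^{r_\theta\times n_R}$, and $\Gamma,\Theta$ the diagonal matrices of the nonzero singular values of $A^{(\{1\})}$ and $A^{(\{1,2\})}$, is the (essentially unique) one for which $A=\mathcal{L}\Gamma\mathcal{N}\Theta\mathcal{R}$ and $\mathcal{L}\,\Gamma\,\mathfrak{R}(\mathcal{N}\Theta\mathcal{R})$, $\mathfrak{L}(\mathcal{L}\Gamma\mathcal{N})\,\Theta\,\mathcal{R}$ are truncated SVDs of $A^{(\{1\})}$, $A^{(\{1,2\})}$; consequently $\mathcal{L}$ and $\mathfrak{L}(\Gamma\mathcal{N})$ have orthonormal columns and $\mathcal{R}$ and $\mathfrak{R}(\mathcal{N}\Theta)$ have orthonormal rows. Variational residual function: for $L\in\mathbb{R}^{n_L\times r_\gamma}$, $N$ a core of $n_N$ matrices in $\mathbb{R}^{r_\gamma\times r_\theta}$, $R\in\mathbb{R}^{r_\theta\times n_R}$, $$C_{B,S,L,N,R}(\widetilde N):=\int_{\mathbb{V}_\omega(L,N,R)}\|(L+s_1\Delta L)(\widetilde N+\Delta N)(R+s_2\Delta R)-B\|_S^2\,\mathrm{d}\Delta L\,\mathrm{d}\Delta N\,\mathrm{d}\Delta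 R,$$ $$\mathbb{V}_\omega(L,N,R):=\{(\Delta L,\Delta N,\Delta R)\mid\|\Delta L\,N\,R\|_F^2+\|L\,\Delta N\,R\|_F^2+\|L\,N\,\Delta R\|_F^2\le\omega^2\},$$ where $\Delta L,\Delta N,\Delta R$ have the shapes of $L,N,R$ and Lebesgue measure is used. If an argmin is not unique (only possible if some $S(j)=\emptyset$), the minimizer with smallest $\|\mathcal{L}\widetilde N\mathcal{R}\|_F$ is taken on both sides. *)

theory Defs
  imports "HOL-Analysis.Analysis"
begin

text \<open>
  An m times k matrix has type \<open>real^'k^'m\<close>, and a core is a finitely indexed family
  \<open>real^'k^'m^'n\<close> of such matrices, so a tensor with entries
  \<open>A(i,j,k)\<close> is accessed as \<open>A $ j $ i $ k\<close>. On both kinds of objects, the library's \<open>norm\<close>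
  (the iterated Euclidean norm of nested vectors) is the Frobenius norm.
\<close>

definition core_lmult :: "real^'m^'p \<Rightarrow> (real^'k^'m^'n) \<Rightarrow> (real^'k^'p^'n)"
    (infixr "*lc" 71) where
  "L *lc H = (\<chi> j. L ** H $ j)"

definition core_rmult :: "(real^'k^'m^'n) \<Rightarrow> real^'q^'k \<Rightarrow> (real^'q^'m^'n)"
    (infixl "*rc" 72) where
  "H *rc R = (\<chi> j. H $ j ** R)"

definition left_unfolding :: "(real^'k^'m^'n) \<Rightarrow> real^'k^('n \<times> 'm)" where
  "left_unfolding H = (\<chi> p. H $ fst p $ snd p)"

definition right_unfolding :: "(real^'k^'m^'n) \<Rightarrow> real^('n \<times> 'k)^'m" where
  "right_unfolding H = (\<chi> i p. H $ fst p $ i $ snd p)"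

definition tt_rank :: "(real^'k^'m^'n) \<Rightarrow> nat \<times> nat" where
  "tt_rank A = (rank (right_unfolding A), rank (left_unfolding A))"

text \<open>
  Only the nonzero singular values are kept, so the diagonal is strictly positive. The index
  type of the singular values carries no order, so they may be listed in any order
  (in particular in the usual decreasing one).
\<close>

definition truncated_svd :: "real^'k^'m \<Rightarrow> real^'r^'m \<Rightarrow> real^'r^'r \<Rightarrow> real^'k^'r \<Rightarrow> bool" where
  "truncated_svd M U \<Sigma> V \<longleftrightarrow>
     M = U ** \<Sigma> ** V \<and>
     transpose U ** U = mat 1 \<and>
     V ** transpose V = mat 1 \<and>
     (\<forall>a b. a \<noteq> b \<longrightarrow> \<Sigma> $ a $ b = 0) \<and>
     (\<forall>a. \<Sigma> $ a $ a > 0)"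

definition standard_representation ::
  "(real^'r^'l^'n) \<Rightarrow> real^'g^'l \<Rightarrow> real^'g^'g \<Rightarrow> (real^'t^'g^'n) \<Rightarrow> real^'t^'t \<Rightarrow> real^'r^'t
     \<Rightarrow> bool" where
  "standard_representation A L \<Gamma> N \<Theta> R \<longleftrightarrow>
     A = (L ** \<Gamma>) *lc N *rc (\<Theta> ** R) \<and>
     truncated_svd (right_unfolding A) L \<Gamma> (right_unfolding (N *rc \<Theta> *rc R)) \<and>
     truncated_svd (left_unfolding A) (left_unfolding ((L ** \<Gamma>) *lc N)) \<Theta> R"

definition slice :: "('l \<times> 'n \<times> 'r) set \<Rightarrow> 'n \<Rightarrow> ('l \<times> 'r) set" where
  "slice S j = {(i, k). (i, j, k) \<in> S}"

text \<open>The squared seminorms \<open>\<parallel>T\<parallel>\<^sub>S\<^sup>2\<close> on cores and on single matrices.\<close>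

definition core_seminorm_sq :: "('l \<times> 'n \<times> 'r) set \<Rightarrow> (real^'r^'l^'n) \<Rightarrow> real" where
  "core_seminorm_sq S T = (\<Sum>(i, j, k)\<in>S. (T $ j $ i $ k)\<^sup>2)"

definition matrix_seminorm_sq :: "('l \<times> 'r) set \<Rightarrow> real^'r^'l \<Rightarrow> real" where
  "matrix_seminorm_sq P M = (\<Sum>(i, k)\<in>P. (M $ i $ k)\<^sup>2)"

definition variation_domain ::
  "real \<Rightarrow> real^'g^'l \<Rightarrow> (real^'t^'g^'n) \<Rightarrow> real^'r^'t
     \<Rightarrow> ((real^'g^'l) \<times> (real^'t^'g^'n) \<times> (real^'r^'t)) set" where
  "variation_domain \<omega> L N R =
     {(dL, dN, dR). (norm (dL *lc N *rc R))\<^sup>2 + (norm (L *lc dN *rc R))\<^sup>2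
        + (norm (L *lc N *rc dR))\<^sup>2 \<le> \<omega>\<^sup>2}"

text \<open>
  If \<open>L\<close>, \<open>N\<close>, \<open>R\<close> come from a standard representation, the domain is compact and the integrand
  is polynomial, so the integral below is a genuine one. The Lebesgue measure is the one of the
  product of the Euclidean spaces containing \<open>dL\<close>, \<open>dN\<close>, \<open>dR\<close>.
\<close>

definition variational_residual ::
  "real \<Rightarrow> real \<Rightarrow> real \<Rightarrow> (real^'r^'l^'n) \<Rightarrow> ('l \<times> 'n \<times> 'r) set
     \<Rightarrow> real^'g^'l \<Rightarrow> (real^'t^'g^'n) \<Rightarrow> real^'r^'t \<Rightarrow> (real^'t^'g^'n) \<Rightarrow> real" where
  "variational_residual \<omega> s\<^sub>1 s\<^sub>2 B S L N R X =
     set_lebesgue_integral lborel (variation_domain \<omega> L N R)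
       (\<lambda>(dL, dN, dR).
          core_seminorm_sq S ((L + s\<^sub>1 *\<^sub>R dL) *lc (X + dN) *rc (R + s\<^sub>2 *\<^sub>R dR) - B))"

text \<open>
  The matrices \<open>R\<close> with columns \<open>S(j)\<^sub>2\<close> and \<open>L\<close> with rows \<open>S(j)\<^sub>1\<close> have \<open>|S(j)|\<close> columns, resp.
  rows. This number depends on \<open>j\<close> and may be zero, so it cannot be a type: such a matrix is
  represented by the list of its columns, resp. rows. Repetitions are kept.
\<close>

definition select_columns :: "real^'k^'m \<Rightarrow> 'k list \<Rightarrow> (real^'m) list" where
  "select_columns M ks = map (\<lambda>k. column k M) ks"

definition select_rows :: "real^'k^'m \<Rightarrow> 'm list \<Rightarrow> (real^'k) list" where
  "select_rows M is = map (\<lambda>i. row i M) is"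

definition mult_columns :: "real^'m^'p \<Rightarrow> (real^'m) list \<Rightarrow> (real^'p) list" where
  "mult_columns M cs = map (\<lambda>c. M *v c) cs"

definition mult_rows :: "(real^'m) list \<Rightarrow> real^'p^'m \<Rightarrow> (real^'p) list" where
  "mult_rows rs M = map (\<lambda>r. r v* M) rs"

definition list_frobenius_sq :: "(real^'m) list \<Rightarrow> real" where
  "list_frobenius_sq vs = (\<Sum>v\<leftarrow>vs. (norm v)\<^sup>2)"

text \<open>Here \<open>xs\<close> is an enumeration of \<open>P = S(j)\<close>, and \<open>X\<close> is the matrix to be optimized.\<close>

definition regularizer ::
  "real \<Rightarrow> real \<Rightarrow> real \<Rightarrow> real \<Rightarrow> real^'g^'l \<Rightarrow> real^'g^'g \<Rightarrow> real^'t^'t \<Rightarrow> real^'r^'t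
     \<Rightarrow> ('l \<times> 'r) set \<Rightarrow> ('l \<times> 'r) list \<Rightarrow> real^'t^'g \<Rightarrow> real" where
  "regularizer \<omega> \<zeta>\<^sub>1 \<zeta>\<^sub>2 \<zeta>\<^sub>1\<^sub>2 L \<Gamma> \<Theta> R P xs X =
     inverse (real CARD('l)) * \<zeta>\<^sub>1 * \<omega>^2
       * list_frobenius_sq (mult_columns (matrix_inv \<Gamma> ** X) (select_columns R (map snd xs)))
     + inverse (real CARD('r)) * \<zeta>\<^sub>2 * \<omega>^2
       * list_frobenius_sq (mult_rows (select_rows L (map fst xs)) (X ** matrix_inv \<Theta>))
     + real (card P) * inverse (real CARD('r) * real CARD('l)) * \<zeta>\<^sub>1\<^sub>2 * \<omega>^4
       * (norm (matrix_inv \<Gamma> ** X ** matrix_inv \<Theta>))\<^sup>2"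

text \<open>Minimizers of \<open>f\<close>, where ties are resolved by minimality of \<open>g\<close> among all minimizers.\<close>

definition is_arg_min_tiebreak :: "('a \<Rightarrow> real) \<Rightarrow> ('a \<Rightarrow> real) \<Rightarrow> 'a \<Rightarrow> bool" where
  "is_arg_min_tiebreak f g x \<longleftrightarrow> is_arg_min g (is_arg_min f (\<lambda>_. True)) x"

end

theory Submission
  imports Defs "HOL-Probability.Distributions"
begin

text \<open>
  The substitution \<open>dL = U \<Gamma>\<^sup>-\<^sup>1\<close>, \<open>dR = \<Theta>\<^sup>-\<^sup>1 V\<close> turns the domain of integration into the Euclidean
  ball of radius \<open>\<omega>\<close>, because all interfaces of the standard representation are orthonormal. It is
  diagonal in the standard basis, so it only contributes a constant Jacobian. Reflecting \<open>U\<close>, \<open>dN\<close>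
  or \<open>V\<close> shows that all mixed terms of the squared residual integrate to zero and that \<open>dN\<close> only
  contributes a constant. The remaining terms are second and fourth moments of the coordinates over
  the ball. They give, up to an affine change, the sum over \<open>j\<close> of the slice functionals; such a
  separable sum is minimized slicewise, also with respect to the tie-break. For a nonempty
  slice the last regularization term makes the functional strongly convex, and for an
  empty slice the functional vanishes, so that the tie-break selects \<open>0\<close>.
\<close>

subsection \<open>Moments of coordinates over a ball\<close>

lemma cball_borel [measurable]: "cball x r \<in> sets borel"
  by simp

text \<open>In the substitution \<open>x = r y\<close> the Jacobian gives \<open>r ^ DIM('a)\<close>
  and homogeneity gives \<open>r ^ d\<close>. Negative values of \<open>p\<close> are cut off by
  \<open>ennreal\<close>, which commutes with the positive factor \<open>r ^ d\<close>.\<close>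

lemma nn_integral_cball_homogeneous:
  fixes p :: "'a::euclidean_space \<Rightarrow> real"
  assumes [measurable]: "p \<in> borel_measurable borel"
    and hom: "\<And>c x. p (c *\<^sub>R x) = c ^ d * p x"
    and "r > 0"
  shows "(\<integral>\<^sup>+x. ennreal (p x) * indicator (cball 0 r) x \<partial>lborel)
    = ennreal (r ^ (DIM('a) + d)) * (\<integral>\<^sup>+x. ennreal (p x) * indicator (cball 0 1) x \<partial>lborel)"
proof -
  have "(\<integral>\<^sup>+x. ennreal (p x) * indicator (cball 0 r) x \<partial>lborel)
    = (\<integral>\<^sup>+x. ennreal (p x) * indicator (cball 0 r) x
         \<partial>density (distr lborel borel (\<lambda>x::'a. 0 + r *\<^sub>R x)) (\<lambda>_. ennreal (\<bar>r\<bar> ^ DIM('a))))"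
    using lborel_affine[of r "0::'a"] \<open>r > 0\<close> by simp
  also have "\<dots> = (\<integral>\<^sup>+x. ennreal (\<bar>r\<bar> ^ DIM('a))
      * (ennreal (p (r *\<^sub>R x)) * indicator (cball 0 r) (r *\<^sub>R x)) \<partial>lborel)"
    by (subst nn_integral_density) (simp_all add: nn_integral_distr)
  also have "\<dots> = (\<integral>\<^sup>+x. ennreal (r ^ (DIM('a) + d))
      * (ennreal (p x) * indicator (cball 0 1) x) \<partial>lborel)"
    using \<open>r > 0\<close>
    by (intro nn_integral_cong)
       (auto simp: hom ennreal_mult'' power_add mult_ac indicator_def)
  finally show ?thesis
    by (simp add: nn_integral_cmult)
qed

text \<open>Read from right to left, this writes \<open>exp (- s)\<close> as an integral over levels
  \<open>t\<close>. For \<open>s = (norm x)\<^sup>2 / 2\<close> the points \<open>x\<close> that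
  contribute to a positive level \<open>t\<close> form a ball.\<close>

lemma nn_integral_exp_atLeast:
  "(\<integral>\<^sup>+t. ennreal (exp (- t)) * indicator {s..} t \<partial>lborel) = ennreal (exp (- s :: real))"
proof -
  have "((\<lambda>t::real. exp (- t)) \<longlongrightarrow> 0) at_top"
    by (rule filterlim_compose[OF exp_at_bot filterlim_uminus_at_bot_at_top])
  then have "((\<lambda>t::real. - exp (- t)) \<longlongrightarrow> 0) at_top"
    using tendsto_minus by fastforce
  from nn_integral_FTC_atLeast[where F = "\<lambda>t. - exp (- t)" and a = s, OF _ _ _ this, of "\<lambda>t. exp (- t)"]
  show ?thesis
    by (simp add: mult.commute) (fastforce intro!: derivative_eq_intros)
qed

text \<open>Layer-cake argument: the Gaussian is replaced by an integral over levels and the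
  integrals are exchanged. For fixed \<open>t\<close> the inner integral runs over the ball of
  radius \<open>sqrt (2 * t)\<close> and scales like \<open>(2 * t) powr m\<close>; integrating this
  against \<open>exp (- t)\<close> gives the Gamma factor.\<close>

lemma nn_integral_gaussian_homogeneous:
  fixes p :: "'a::euclidean_space \<Rightarrow> real"
  assumes [measurable]: "p \<in> borel_measurable borel"
    and hom: "\<And>c x. p (c *\<^sub>R x) = c ^ d * p x"
    and nn: "\<And>x. p x \<ge> 0"
  defines "m \<equiv> real (DIM('a) + d) / 2"
  shows "(\<integral>\<^sup>+x. ennreal (p x * exp (- (norm x)\<^sup>2 / 2)) \<partial>lborel)
    = ennreal (2 powr m * Gamma (m + 1)) * (\<integral>\<^sup>+x. ennreal (p x) * indicator (cball 0 1) x \<partial>lborel)"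
proof -
  let ?I = "\<integral>\<^sup>+x. ennreal (p x) * indicator (cball 0 1) x \<partial>lborel"
  have m: "m > 0"
    unfolding m_def by (simp add: add_pos_nonneg)
  have "(\<integral>\<^sup>+x. ennreal (p x * exp (- (norm x)\<^sup>2 / 2)) \<partial>lborel)
    = (\<integral>\<^sup>+x. \<integral>\<^sup>+t. ennreal (p x) * (ennreal (exp (- t)) * indicator {(norm x)\<^sup>2 / 2..} t) \<partial>lborel \<partial>lborel)"
    by (simp add: nn_integral_cmult nn_integral_exp_atLeast ennreal_mult nn)
  also have "\<dots> = (\<integral>\<^sup>+t. \<integral>\<^sup>+x. ennreal (p x) * (ennreal (exp (- t)) * indicator {(norm x)\<^sup>2 / 2..} t) \<partial>lborel \<partial>lborel)"
    by (rule lborel_pair.Fubini'[symmetric], measurable, unfold atLeast_iff, measurable)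
  also have "\<dots> = (\<integral>\<^sup>+t. ?I * ennreal (2 powr m * (indicator {0..} t * t powr m / exp t)) \<partial>lborel)"
  \<comment> \<open>The null set \<open>t = 0\<close> is dropped because the scaling lemma needs a
    positive radius; for \<open>t < 0\<close> both sides vanish.\<close>
  proof (rule nn_integral_cong_AE, use AE_lborel_singleton[of "0::real"] in eventually_elim)
    fix t :: real
    assume "t \<noteq> 0"
    show "(\<integral>\<^sup>+x. ennreal (p x) * (ennreal (exp (- t)) * indicator {(norm x)\<^sup>2 / 2..} t) \<partial>lborel)
      = ?I * ennreal (2 powr m * (indicator {0..} t * t powr m / exp t))"
    proof (cases "t > 0")
      case True
      have *: "(norm x)\<^sup>2 / 2 \<le> t \<longleftrightarrow> norm x \<le> sqrt (2 * t)" for x :: 'a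
        using real_sqrt_le_iff[of "(norm x)\<^sup>2" "2 * t"] by (auto simp del: real_sqrt_le_iff)
      have "(\<integral>\<^sup>+x. ennreal (p x) * (ennreal (exp (- t)) * indicator {(norm x)\<^sup>2 / 2..} t) \<partial>lborel)
        = (\<integral>\<^sup>+x. ennreal (exp (- t)) * (ennreal (p x) * indicator (cball 0 (sqrt (2 * t))) x) \<partial>lborel)"
        using * by (intro nn_integral_cong) (auto simp: indicator_def mult_ac)
      also have "\<dots> = ennreal (exp (- t)) * (ennreal (sqrt (2 * t) ^ (DIM('a) + d)) * ?I)"
        using True by (simp add: nn_integral_cmult nn_integral_cball_homogeneous[OF assms(1) hom, of "sqrt (2 * t)"])
      also have "sqrt (2 * t) ^ (DIM('a) + d) = (2 * t) powr m"
        using True by (simp add: m_def powr_half_sqrt[symmetric] powr_realpow[symmetric] powr_powr)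
      also have "ennreal (exp (- t)) * (ennreal ((2 * t) powr m) * ?I)
         = ?I * (ennreal (exp (- t)) * ennreal ((2 * t) powr m))"
        by (simp add: mult_ac)
      also have "ennreal (exp (- t)) * ennreal ((2 * t) powr m)
        = ennreal (2 powr m * (indicator {0..} t * t powr m / exp t))"
        using True by (simp add: ennreal_mult'[symmetric] powr_mult exp_minus field_simps)
      finally show ?thesis .
    next
      case False
      then have "\<not> (norm x)\<^sup>2 / 2 \<le> t" for x :: 'a
        using \<open>t \<noteq> 0\<close> zero_le_power2[of "norm x"] by linarith
      then show ?thesis
        using False \<open>t \<noteq> 0\<close> by (simp add: indicator_def)
    qed
  qed
  \<comment> \<open>The exponent is written as \<open>m + 1 - 1\<close> to match Euler's integral
    for \<open>Gamma (m + 1)\<close>.\<close>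
  also have "\<dots> = ?I * (ennreal (2 powr m) * (\<integral>\<^sup>+t. ennreal (indicator {0..} t * t powr (m + 1 - 1) / exp t) \<partial>lborel))"
    unfolding ennreal_mult'[OF powr_ge_zero] by (simp add: nn_integral_cmult)
  also have "\<dots> = ennreal (2 powr m * Gamma (m + 1)) * ?I"
    using m by (subst Gamma_conv_nn_integral_real[symmetric]) (auto simp: ennreal_mult' mult_ac)
  finally show ?thesis .
qed

text \<open>The Gaussian factorizes over the coordinates. Up to \<open>sqrt (2 * pi)\<close>, each
  factor is a moment of order 0 or 2 of the standard normal distribution; both moments are 1, so the
  value does not depend on \<open>A\<close>.\<close>

lemma gaussian_moment_product:
  fixes A :: "'a::euclidean_space set"
  assumes "A \<subseteq> Basis"
  shows "(\<integral>\<^sup>+x. ennreal ((\<Prod>b\<in>A. (x \<bullet> b)\<^sup>2) * exp (- (norm x)\<^sup>2 / 2)) \<partial>lborel)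
    = ennreal (sqrt (2 * pi) ^ DIM('a))"
proof -
  have one: "(\<integral>\<^sup>+t. ennreal (exp (- t\<^sup>2 / 2) * t ^ (2 * k)) \<partial>lborel) = ennreal (sqrt (2 * pi))"
    if "k \<in> {0, 1}" for k
  proof -
    \<comment> \<open>This is the normal moment of order \<open>2 * k\<close>. It would be 3 for
      \<open>k = 2\<close>, but as \<open>A\<close> is a set, no coordinate occurs with a higher
      power than its square.\<close>
    have "fact (2 * k) / (2 ^ k * fact k) = (1::real)"
      using that by auto
    then have "has_bochner_integral lborel (\<lambda>x. std_normal_density x * x ^ (2 * k)) 1"
      using std_normal_moment_even[of k] by simp
    then have "(\<integral>\<^sup>+x. ennreal (std_normal_density x * x ^ (2 * k)) \<partial>lborel) = ennreal 1"
      by (subst nn_integral_eq_integral)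
         (auto simp: has_bochner_integral_iff zero_le_mult_iff)
    moreover have "(\<integral>\<^sup>+t. ennreal (exp (- t\<^sup>2 / 2) * t ^ (2 * k)) \<partial>lborel)
      = (\<integral>\<^sup>+t. ennreal (sqrt (2 * pi)) * ennreal (std_normal_density t * t ^ (2 * k)) \<partial>lborel)"
      by (intro nn_integral_cong) (simp add: ennreal_mult'[symmetric] std_normal_density_def)
    ultimately show ?thesis
      by (simp add: nn_integral_cmult)
  qed
  have "(\<Prod>b\<in>A. (x \<bullet> b)\<^sup>2) * exp (- (norm x)\<^sup>2 / 2)
    = (\<Prod>b\<in>Basis. exp (- (x \<bullet> b)\<^sup>2 / 2) * (x \<bullet> b) ^ (2 * (if b \<in> A then 1 else 0)))" for x
  proof -
    have "(norm x)\<^sup>2 = (\<Sum>b\<in>Basis. (x \<bullet> b)\<^sup>2)"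
      unfolding power2_norm_eq_inner by (subst euclidean_inner) (simp add: power2_eq_square)
    then have "exp (- (norm x)\<^sup>2 / 2) = (\<Prod>b\<in>Basis. exp (- (x \<bullet> b)\<^sup>2 / 2))"
      by (simp add: exp_sum[symmetric] sum_negf sum_divide_distrib)
    moreover have "(\<Prod>b\<in>A. (x \<bullet> b)\<^sup>2) = (\<Prod>b\<in>Basis. (x \<bullet> b) ^ (2 * (if b \<in> A then 1 else 0)))"
      using assms by (intro prod.mono_neutral_cong_left) auto
    ultimately show ?thesis
      by (simp add: prod.distrib)
  qed
  then have "(\<integral>\<^sup>+x. ennreal ((\<Prod>b\<in>A. (x \<bullet> b)\<^sup>2) * exp (- (norm x)\<^sup>2 / 2)) \<partial>lborel)
    = (\<integral>\<^sup>+x. (\<Prod>b\<in>Basis. ennreal (exp (- (x \<bullet> b)\<^sup>2 / 2) * (x \<bullet> b) ^ (2 * (if b \<in> A then 1 else 0)))) \<partial>lborel)"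
    by (simp add: prod_ennreal)
  also have "\<dots> = (\<Prod>b\<in>(Basis::'a set). \<integral>\<^sup>+t. ennreal (exp (- t\<^sup>2 / 2) * t ^ (2 * (if b \<in> A then 1 else 0))) \<partial>lborel)"
    by (rule nn_integral_lborel_prod) auto
  also have "\<dots> = ennreal (sqrt (2 * pi) ^ DIM('a))"
    by (subst one) (auto simp: ennreal_power)
  finally show ?thesis .
qed

text \<open>The integral of a homogeneous polynomial over the ball and its Gaussian integral differ by an
  explicit factor that depends only on the degree, so the moments over the ball can be
  read off from those of independent normal variables.\<close>

lemma nn_integral_cball_moment:
  fixes A :: "'a::euclidean_space set"
  assumes "A \<subseteq> Basis" and "r > 0"
  defines "m \<equiv> real (DIM('a)) / 2 + real (card A)"
  shows "(\<integral>\<^sup>+x. ennreal (\<Prod>b\<in>A. (x \<bullet> b)\<^sup>2) * indicator (cball 0 r) x \<partial>lborel)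
    = ennreal (r ^ (DIM('a) + 2 * card A) * sqrt (2 * pi) ^ DIM('a) / (2 powr m * Gamma (m + 1)))"
proof -
  let ?p = "\<lambda>x. \<Prod>b\<in>A. (x \<bullet> b)\<^sup>2"
  let ?I = "\<integral>\<^sup>+x. ennreal (?p x) * indicator (cball 0 1) x \<partial>lborel"
  have hom: "?p (c *\<^sub>R x) = c ^ (2 * card A) * ?p x" for c x
    by (simp add: power_mult_distrib prod.distrib power_mult)
  have m: "real (DIM('a) + 2 * card A) / 2 = m"
    by (simp add: m_def add_divide_distrib)
  have c: "2 powr m * Gamma (m + 1) > 0"
    by (intro mult_pos_pos Gamma_real_pos) (auto simp: m_def add_nonneg_pos)
  have "ennreal (2 powr m * Gamma (m + 1)) * ?I = ennreal (sqrt (2 * pi) ^ DIM('a))"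
    using nn_integral_gaussian_homogeneous[of ?p "2 * card A", OF _ hom] gaussian_moment_product[OF assms(1)]
    unfolding m by (simp add: prod_nonneg)
  \<comment> \<open>The constant lies strictly between 0 and infinity, so it can be cancelled in
    \<open>ennreal\<close>.\<close>
  then have "?I * ennreal (2 powr m * Gamma (m + 1)) / ennreal (2 powr m * Gamma (m + 1))
    = ennreal (sqrt (2 * pi) ^ DIM('a)) / ennreal (2 powr m * Gamma (m + 1))"
    by (simp only: mult.commute)
  then have "?I = ennreal (sqrt (2 * pi) ^ DIM('a)) / ennreal (2 powr m * Gamma (m + 1))"
    using c by (subst (asm) ennreal_mult_divide_eq) auto
  also have "\<dots> = ennreal (sqrt (2 * pi) ^ DIM('a) / (2 powr m * Gamma (m + 1)))"
    using c by (intro divide_ennreal) auto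
  finally have "?I = \<dots>" .
  then show ?thesis
    using nn_integral_cball_homogeneous[of ?p "2 * card A" r, OF _ hom \<open>r > 0\<close>] \<open>r > 0\<close>
    by (simp add: ennreal_mult'[symmetric])
qed

section \<open>Second and fourth moments as real-valued integrals\<close>

definition ball_integral :: "real \<Rightarrow> ('a::euclidean_space \<Rightarrow> real) \<Rightarrow> real" where
  "ball_integral r f = (LINT x:cball 0 r|lborel. f x)"

lemma ball_integral_moment:
  fixes A :: "'a::euclidean_space set"
  assumes "A \<subseteq> Basis" and "r > 0"
  defines "m \<equiv> real (DIM('a)) / 2 + real (card A)"
  shows "ball_integral r (\<lambda>x. \<Prod>b\<in>A. (x \<bullet> b)\<^sup>2)
    = r ^ (DIM('a) + 2 * card A) * sqrt (2 * pi) ^ DIM('a) / (2 powr m * Gamma (m + 1))"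
proof -
  have c: "2 powr m * Gamma (m + 1) > 0"
    by (intro mult_pos_pos Gamma_real_pos) (auto simp: m_def add_nonneg_pos)
  have "ball_integral r (\<lambda>x::'a. \<Prod>b\<in>A. (x \<bullet> b)\<^sup>2) = enn2real (\<integral>\<^sup>+x. ennreal (indicator (cball 0 r) x * (\<Prod>b\<in>A. (x \<bullet> b)\<^sup>2)) \<partial>lborel)"
    unfolding ball_integral_def set_lebesgue_integral_def real_scaleR_def
    by (rule integral_eq_nn_integral) (auto intro!: AE_I2 mult_nonneg_nonneg prod_nonneg)
  also have "(\<integral>\<^sup>+x. ennreal (indicator (cball 0 r) x * (\<Prod>b\<in>A. (x \<bullet> b)\<^sup>2)) \<partial>lborel)
    = (\<integral>\<^sup>+x. ennreal (\<Prod>b\<in>A. (x \<bullet> b)\<^sup>2) * indicator (cball 0 r) x \<partial>lborel)"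
    by (intro nn_integral_cong) (auto simp: indicator_def)
  also note nn_integral_cball_moment[OF assms(1,2)]
  finally show ?thesis
    using c \<open>r > 0\<close> unfolding m_def by (simp del: enn2real_ennreal add: enn2real_ennreal[OF divide_nonneg_pos])
qed

text \<open>The three values are the cases of 0, 1 and 2 elements in
  \<open>ball_integral_moment\<close>. Each further coordinate contributes \<open>r\<^sup>2\<close>,
  a factor 1/2 and, by the functional equation of \<open>Gamma\<close>, first
  \<open>1 / (h + 1)\<close> and then \<open>1 / (h + 2)\<close> with
  \<open>h = DIM('a) / 2\<close>. This is the origin of \<open>D + 2\<close> and
  \<open>D + 4\<close>.\<close>

lemma ball_integral_moments:
  fixes r :: real
  assumes "r > 0"
  defines "V \<equiv> ball_integral r (\<lambda>_::'a::euclidean_space. 1)"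
  shows ball_integral_1_pos: "V > 0"
    and ball_integral_sq: "\<And>b. b \<in> Basis \<Longrightarrow>
      ball_integral r (\<lambda>x::'a. (x \<bullet> b)\<^sup>2) = V * (r\<^sup>2 / (DIM('a) + 2))"
    and ball_integral_sq_sq: "\<And>b c. b \<in> Basis \<Longrightarrow> c \<in> Basis \<Longrightarrow> b \<noteq> c \<Longrightarrow>
      ball_integral r (\<lambda>x::'a. (x \<bullet> b)\<^sup>2 * (x \<bullet> c)\<^sup>2) = V * (r ^ 4 / ((DIM('a) + 2) * (DIM('a) + 4)))"
proof -
  define h where "h = real DIM('a) / 2"
  have h: "h > 0"
    by (simp add: h_def)
  have D: "real DIM('a) = 2 * h"
    by (simp add: h_def)
  have G: "Gamma (h + 1) > 0"
    using h by (intro Gamma_real_pos) auto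
  have G1: "Gamma (h + 2) = (h + 1) * Gamma (h + 1)"
    using Gamma_plus1[of "h + 1"] h by (force dest: nonpos_Ints_nonpos simp: add.assoc)
  have G2: "Gamma (h + 3) = (h + 2) * ((h + 1) * Gamma (h + 1))"
    using Gamma_plus1[of "h + 2"] h G1 by (force dest: nonpos_Ints_nonpos simp: add.assoc)
  have V: "V = r ^ DIM('a) * sqrt (2 * pi) ^ DIM('a) / (2 powr h * Gamma (h + 1))"
    unfolding V_def using ball_integral_moment[of "{}::'a set" r] assms by (simp add: h_def)
  show "V > 0"
    unfolding V using assms G by simp
  show "ball_integral r (\<lambda>x::'a. (x \<bullet> b)\<^sup>2) = V * (r\<^sup>2 / (DIM('a) + 2))" if "b \<in> Basis" for b
  proof -
    have "ball_integral r (\<lambda>x::'a. (x \<bullet> b)\<^sup>2)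
      = r ^ DIM('a) * r\<^sup>2 * sqrt (2 * pi) ^ DIM('a) / (2 powr h * 2 * Gamma (h + 2))"
      using ball_integral_moment[of "{b}" r] assms(1) that
      by (simp add: h_def[symmetric] powr_add power2_eq_square add.assoc)
    then show ?thesis
      using h G unfolding V G1 by (simp add: D) (simp add: field_simps)
  qed
  show "ball_integral r (\<lambda>x::'a. (x \<bullet> b)\<^sup>2 * (x \<bullet> c)\<^sup>2) = V * (r ^ 4 / ((DIM('a) + 2) * (DIM('a) + 4)))"
    if "b \<in> Basis" "c \<in> Basis" "b \<noteq> c" for b c
  proof -
    have "ball_integral r (\<lambda>x::'a. (x \<bullet> b)\<^sup>2 * (x \<bullet> c)\<^sup>2)
      = r ^ DIM('a) * r ^ 4 * sqrt (2 * pi) ^ DIM('a) / (2 powr h * 4 * Gamma (h + 3))"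
      using ball_integral_moment[of "{b, c}" r] assms(1) that
      by (simp add: h_def[symmetric] powr_add power_add add.assoc mult.assoc)
    also have "\<dots> = V * (r ^ 4 / ((2 * h + 2) * (2 * h + 4)))"
      using h G unfolding V G2 by (simp add: divide_simps) (simp add: algebra_simps)
    finally show ?thesis
      by (simp only: of_nat_mult of_nat_add of_nat_numeral D)
  qed
qed

text \<open>A coordinatewise scaling has the product of the absolute diagonal entries as its
  Jacobian. The rule serves both the reflections and the substitution that turns the domain into a
  ball.\<close>

lemma integral_lborel_diagonal:
  fixes T :: "'a::euclidean_space \<Rightarrow> 'a" and f :: "'a \<Rightarrow> real"
  assumes "linear T" and T: "\<And>b. b \<in> Basis \<Longrightarrow> \<exists>k. k \<noteq> 0 \<and> T b = k *\<^sub>R b"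
    and [measurable]: "f \<in> borel_measurable borel"
  shows "(LINT x|lborel. f x) = (\<Prod>b\<in>Basis. \<bar>T b \<bullet> b\<bar>) * (LINT x|lborel. f (T x))"
proof -
  interpret linear T by fact
  have diag: "T b = (T b \<bullet> b) *\<^sub>R b" "T b \<bullet> b \<noteq> 0" if "b \<in> Basis" for b
    using T[OF that] that by auto
  have T_eq: "T x = 0 + (\<Sum>b\<in>Basis. ((T b \<bullet> b) * (x \<bullet> b)) *\<^sub>R b)" for x
  proof -
    have "T x = T (\<Sum>b\<in>Basis. (x \<bullet> b) *\<^sub>R b)"
      by (simp add: euclidean_representation)
    also have "\<dots> = (\<Sum>b\<in>Basis. (x \<bullet> b) *\<^sub>R T b)"
      by (simp add: sum scaleR)
    also have "\<dots> = (\<Sum>b\<in>Basis. (x \<bullet> b) *\<^sub>R ((T b \<bullet> b) *\<^sub>R b))"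
      using diag(1) by (intro sum.cong) auto
    finally show ?thesis
      by (simp add: mult.commute)
  qed
  have [measurable]: "T \<in> borel_measurable borel"
    using \<open>linear T\<close> by (intro borel_measurable_continuous_onI linear_continuous_on linear_conv_bounded_linear[THEN iffD1])
  have "lborel = density (distr lborel borel T) (\<lambda>_. ennreal (\<Prod>b\<in>Basis. \<bar>T b \<bullet> b\<bar>))"
    using lborel_affine_euclidean[of "\<lambda>b. T b \<bullet> b" 0] diag(2) unfolding T_eq[symmetric] by (simp add: eta_contract_eq)
  then have "(LINT x|lborel. f x) = (LINT x|density (distr lborel borel T) (\<lambda>_. ennreal (\<Prod>b\<in>Basis. \<bar>T b \<bullet> b\<bar>)). f x)"
    by simp
  also have "\<dots> = (\<Prod>b\<in>Basis. \<bar>T b \<bullet> b\<bar>) * (LINT x|lborel. f (T x))"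
    by (subst integral_density) (auto simp: integral_distr prod_nonneg)
  finally show ?thesis .
qed

section \<open>Linearity of the integral over the ball\<close>

lemma ball_integrable:
  fixes f :: "'a::euclidean_space \<Rightarrow> real"
  assumes "continuous_on UNIV f"
  shows "set_integrable lborel (cball 0 r) f"
  unfolding set_integrable_def
  using assms by (intro borel_integrable_compact) (auto intro: continuous_on_subset)

lemma ball_integral_add:
  fixes f g :: "'a::euclidean_space \<Rightarrow> real"
  assumes "continuous_on UNIV f" and "continuous_on UNIV g"
  shows "ball_integral r (\<lambda>x. f x + g x) = ball_integral r f + ball_integral r g"
  unfolding ball_integral_def using assms by (intro set_integral_add ball_integrable)

lemma ball_integral_cmult: "ball_integral r (\<lambda>x. c * f x) = c * ball_integral r f"
  unfolding ball_integral_def by simp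

lemma ball_integral_const: "ball_integral r (\<lambda>x::'a::euclidean_space. c) = c * ball_integral r (\<lambda>x::'a. 1)"
  using ball_integral_cmult[of r c "\<lambda>_::'a. 1"] by simp

lemma ball_integral_sum:
  fixes f :: "'i \<Rightarrow> 'a::euclidean_space \<Rightarrow> real"
  assumes "finite I" and "\<And>i. i \<in> I \<Longrightarrow> continuous_on UNIV (f i)"
  shows "ball_integral r (\<lambda>x. \<Sum>i\<in>I. f i x) = (\<Sum>i\<in>I. ball_integral r (f i))"
  using assms
proof (induction I rule: finite_induct)
  case empty
  then show ?case
    using ball_integral_const[of r 0] by simp
next
  case (insert i I)
  then show ?case
    by (simp add: ball_integral_add continuous_on_sum)
qed

section \<open>Reflections of coordinates and the vanishing of odd integrals\<close>

definition coordinate_reflection :: "('a::euclidean_space \<Rightarrow> 'a) \<Rightarrow> bool" where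
  "coordinate_reflection T \<longleftrightarrow> linear T \<and> (\<forall>b\<in>Basis. T b = b \<or> T b = - b)"

lemma norm_coordinate_reflection:
  assumes "coordinate_reflection T"
  shows "norm (T x) = norm x"
proof -
  have T: "linear T" "\<And>b. b \<in> Basis \<Longrightarrow> T b = b \<or> T b = - b"
    using assms by (auto simp: coordinate_reflection_def)
  have orth: "T b \<bullet> T c = b \<bullet> c" if "b \<in> Basis" "c \<in> Basis" for b c
    using T(2)[OF that(1)] T(2)[OF that(2)] that by (cases "b = c") (auto simp: inner_not_same_Basis)
  have Tx: "T x = (\<Sum>b\<in>Basis. (x \<bullet> b) *\<^sub>R T b)"
    by (subst (1) euclidean_representation[of x, symmetric])
       (simp add: linear_sum[OF T(1)] linear_scale[OF T(1)] del: euclidean_representation)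
  have "T x \<bullet> T x = (\<Sum>b\<in>Basis. (x \<bullet> b) *\<^sub>R b) \<bullet> (\<Sum>b\<in>Basis. (x \<bullet> b) *\<^sub>R b)"
    unfolding Tx inner_sum_left inner_sum_right by (simp add: orth)
  then show ?thesis
    by (simp add: norm_eq_sqrt_inner euclidean_representation)
qed

text \<open>A reflection is an isometry, so it preserves the ball, and its Jacobian is a product of
  absolute values of signs. Any set of coordinates may be flipped at once, which covers single
  coordinates as well as whole matrix blocks.\<close>

lemma ball_integral_reflect:
  fixes f :: "'a::euclidean_space \<Rightarrow> real"
  assumes T: "coordinate_reflection T" and f: "continuous_on UNIV f"
  shows "ball_integral r (\<lambda>x. f (T x)) = ball_integral r f"
proof -
  have [measurable]: "f \<in> borel_measurable borel"
    using f by (rule borel_measurable_continuous_onI)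
  have basis: "T b = b \<or> T b = - b" if "b \<in> Basis" for b
    using T that by (auto simp: coordinate_reflection_def)
  have "ball_integral r f = (LINT x|lborel. indicator (cball 0 r) x * f x)"
    by (simp add: ball_integral_def set_lebesgue_integral_def)
  also have "\<dots> = (\<Prod>b\<in>Basis. \<bar>T b \<bullet> b\<bar>) * (LINT x|lborel. indicator (cball 0 r) (T x) * f (T x))"
  proof (rule integral_lborel_diagonal)
    show "\<exists>k. k \<noteq> 0 \<and> T b = k *\<^sub>R b" if "b \<in> Basis" for b
      using basis[OF that] by (metis scaleR_minus1_left scaleR_one neg_equal_0_iff_equal zero_neq_one)
  qed (use T in \<open>auto simp: coordinate_reflection_def\<close>)
  also have "(\<Prod>b\<in>Basis. \<bar>T b \<bullet> b\<bar>) = 1"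
    using basis by (intro prod.neutral ballI) fastforce
  finally show ?thesis
    by (simp add: ball_integral_def set_lebesgue_integral_def indicator_def norm_coordinate_reflection[OF T])
qed

lemma ball_integral_odd:
  fixes f :: "'a::euclidean_space \<Rightarrow> real"
  assumes "coordinate_reflection T" and "continuous_on UNIV f" and "\<And>x. f (T x) = - f x"
  shows "ball_integral r f = 0"
  using ball_integral_reflect[OF assms(1,2), of r] ball_integral_cmult[of r "-1" f] assms(3) by simp

text \<open>The mixed product \<open>f x * g x\<close> is odd under \<open>T\<close>. With a
  suitable \<open>T\<close> for each splitting, the squared residual falls apart into squares of its
  homogeneous parts.\<close>

lemma ball_integral_sq_add:
  fixes f g :: "'a::euclidean_space \<Rightarrow> real"
  assumes T: "coordinate_reflection T"
    and f: "continuous_on UNIV f" "\<And>x. f (T x) = f x"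
    and g: "continuous_on UNIV g" "\<And>x. g (T x) = - g x"
  shows "ball_integral r (\<lambda>x. (f x + g x)\<^sup>2) = ball_integral r (\<lambda>x. (f x)\<^sup>2) + ball_integral r (\<lambda>x. (g x)\<^sup>2)"
proof -
  have "ball_integral r (\<lambda>x. (f x + g x)\<^sup>2)
    = ball_integral r (\<lambda>x. ((f x)\<^sup>2 + (g x)\<^sup>2) + 2 * (f x * g x))"
    by (simp add: power2_sum algebra_simps)
  also have "\<dots> = ball_integral r (\<lambda>x. (f x)\<^sup>2) + ball_integral r (\<lambda>x. (g x)\<^sup>2) + 2 * ball_integral r (\<lambda>x. f x * g x)"
    using f g by (simp add: ball_integral_add ball_integral_cmult continuous_intros)
  also have "ball_integral r (\<lambda>x. f x * g x) = 0"
    using f g by (intro ball_integral_odd[OF T] continuous_intros) auto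
  finally show ?thesis
    by simp
qed

text \<open>Pythagoras for a family of functions that are orthogonal and of equal norm with respect
  to integration over the ball.\<close>

lemma ball_integral_sq_sum_orthogonal:
  fixes \<phi> :: "'i \<Rightarrow> 'a::euclidean_space \<Rightarrow> real"
  assumes "finite I" and cont: "\<And>i. i \<in> I \<Longrightarrow> continuous_on UNIV (\<phi> i)"
    and orth: "\<And>i j. i \<in> I \<Longrightarrow> j \<in> I \<Longrightarrow> i \<noteq> j \<Longrightarrow> ball_integral r (\<lambda>x. \<phi> i x * \<phi> j x) = 0"
    and sq: "\<And>i. i \<in> I \<Longrightarrow> ball_integral r (\<lambda>x. (\<phi> i x)\<^sup>2) = c"
  shows "ball_integral r (\<lambda>x. (\<Sum>i\<in>I. w i * \<phi> i x)\<^sup>2) = c * (\<Sum>i\<in>I. (w i)\<^sup>2)"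
proof -
  have "ball_integral r (\<lambda>x. (\<Sum>i\<in>I. w i * \<phi> i x)\<^sup>2)
    = ball_integral r (\<lambda>x. \<Sum>i\<in>I. \<Sum>j\<in>I. (w i * w j) * (\<phi> i x * \<phi> j x))"
    by (simp add: power2_eq_square sum_product mult_ac)
  also have "\<dots> = (\<Sum>i\<in>I. \<Sum>j\<in>I. (w i * w j) * ball_integral r (\<lambda>x. \<phi> i x * \<phi> j x))"
    using \<open>finite I\<close> cont
    by (simp add: ball_integral_sum ball_integral_cmult continuous_on_sum continuous_on_mult continuous_on_const)
  also have "\<dots> = (\<Sum>i\<in>I. \<Sum>j\<in>I. if j = i then w i * w i * c else 0)"
    using orth sq by (intro sum.cong) (auto simp: power2_eq_square)
  also have "\<dots> = c * (\<Sum>i\<in>I. (w i)\<^sup>2)"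
    using \<open>finite I\<close> by (simp add: sum_distrib_left power2_eq_square mult_ac)
  finally show ?thesis .
qed

text \<open>The reflection in the hyperplane orthogonal to \<open>e\<close> changes the sign of the
  coordinate \<open>x \<bullet> e\<close> and leaves the other factor alone.\<close>

lemma ball_integral_inner_odd:
  fixes e :: "'a::euclidean_space"
  assumes "e \<in> Basis" and "continuous_on UNIV g" and "\<And>x. g (x - (2 * (x \<bullet> e)) *\<^sub>R e) = g x"
  shows "ball_integral r (\<lambda>x. (x \<bullet> e) * g x) = 0"
proof (rule ball_integral_odd)
  show "coordinate_reflection (\<lambda>x. x - (2 * (x \<bullet> e)) *\<^sub>R e)"
    unfolding coordinate_reflection_def
  proof (intro conjI ballI)
    show "linear (\<lambda>x. x - (2 * (x \<bullet> e)) *\<^sub>R e)"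
      by (rule linearI) (simp_all add: inner_add_left algebra_simps)
    show "b - (2 * (b \<bullet> e)) *\<^sub>R e = b \<or> b - (2 * (b \<bullet> e)) *\<^sub>R e = - b" if "b \<in> Basis" for b
      using that \<open>e \<in> Basis\<close> by (auto simp: inner_Basis scaleR_2[of e, symmetric]) (simp add: scaleR_2)
  qed
  show "continuous_on UNIV (\<lambda>x. (x \<bullet> e) * g x)"
    using assms by (intro continuous_intros)
  show "((x - (2 * (x \<bullet> e)) *\<^sub>R e) \<bullet> e) * g (x - (2 * (x \<bullet> e)) *\<^sub>R e) = - (x \<bullet> e * g x)" for x
    using assms by (simp add: inner_diff_left)
qed

text \<open>Different coordinates are orthogonal by oddness; injectivity of \<open>e\<close> ensures
  that different indices do name different coordinates.\<close>

lemma ball_integral_linear_sq: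
  fixes e :: "'i::finite \<Rightarrow> 'a::euclidean_space"
  assumes "inj e" and e: "\<And>i. e i \<in> Basis" and "r > 0"
  shows "ball_integral r (\<lambda>x. (\<Sum>i\<in>UNIV. w i * (x \<bullet> e i))\<^sup>2)
    = ball_integral r (\<lambda>_::'a. 1) * (r\<^sup>2 / (DIM('a) + 2)) * (\<Sum>i\<in>UNIV. (w i)\<^sup>2)"
proof (rule ball_integral_sq_sum_orthogonal)
  fix i j :: 'i
  assume "i \<noteq> j"
  then have "e i \<bullet> e j = 0"
    using e \<open>inj e\<close> by (simp add: inner_Basis inj_eq)
  then show "ball_integral r (\<lambda>x. (x \<bullet> e i) * (x \<bullet> e j)) = 0"
    using e by (intro ball_integral_inner_odd continuous_intros) (auto simp: inner_diff_left)
next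
  show "ball_integral r (\<lambda>x. (x \<bullet> e i)\<^sup>2) = ball_integral r (\<lambda>_::'a. 1) * (r\<^sup>2 / (DIM('a) + 2))" for i
    using e \<open>r > 0\<close> by (intro ball_integral_sq) auto
qed (auto intro!: continuous_intros)

text \<open>Two different products of coordinates differ in at least one factor, which makes them
  orthogonal. Since \<open>e\<close> and \<open>h\<close> never meet, the square of one product is a
  mixed fourth moment and no fourth power of a single coordinate arises.\<close>

lemma ball_integral_bilinear_sq:
  fixes e :: "'i::finite \<Rightarrow> 'a::euclidean_space" and h :: "'k::finite \<Rightarrow> 'a"
  assumes "inj e" and "inj h" and e: "\<And>i. e i \<in> Basis" and h: "\<And>k. h k \<in> Basis"
    and disj: "\<And>i k. e i \<noteq> h k" and "r > 0"
  shows "ball_integral r (\<lambda>x. (\<Sum>i\<in>UNIV. \<Sum>k\<in>UNIV. w i k * ((x \<bullet> e i) * (x \<bullet> h k)))\<^sup>2)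
    = ball_integral r (\<lambda>_::'a. 1) * (r ^ 4 / ((DIM('a) + 2) * (DIM('a) + 4)))
      * (\<Sum>i\<in>UNIV. \<Sum>k\<in>UNIV. (w i k)\<^sup>2)"
proof -
  define \<phi> where "\<phi> = (\<lambda>p x. (x \<bullet> e (fst p)) * (x \<bullet> h (snd p)))"
  have eh: "e i \<bullet> h k = 0" "h k \<bullet> e i = 0" for i k
    using e h disj[of i k] by (auto simp: inner_Basis)
  have ee: "e i \<bullet> e j = 0" if "i \<noteq> j" for i j
    using e \<open>inj e\<close> that by (simp add: inner_Basis inj_eq)
  have hh: "h i \<bullet> h j = 0" if "i \<noteq> j" for i j
    using h \<open>inj h\<close> that by (simp add: inner_Basis inj_eq)
  have orth: "ball_integral r (\<lambda>x. \<phi> p x * \<phi> q x) = 0" if "p \<noteq> q" for p q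
  \<comment> \<open>Whichever index differs, the coordinate it selects in the product for
    \<open>p\<close> occurs nowhere else in the integrand and can be reflected.\<close>
  proof (cases "fst p = fst q")
    case False
    have "ball_integral r (\<lambda>x. (x \<bullet> e (fst p)) * ((x \<bullet> h (snd p)) * \<phi> q x)) = 0"
      unfolding \<phi>_def using e eh ee[OF False]
      by (intro ball_integral_inner_odd continuous_intros) (auto simp: inner_diff_left)
    then show ?thesis
      by (simp add: \<phi>_def mult_ac)
  next
    case True
    then have "snd p \<noteq> snd q"
      using that by (auto simp: prod_eq_iff)
    then have "ball_integral r (\<lambda>x. (x \<bullet> h (snd p)) * ((x \<bullet> e (fst p)) * \<phi> q x)) = 0"
      unfolding \<phi>_def using h eh hh
      by (intro ball_integral_inner_odd continuous_intros) (auto simp: inner_diff_left)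
    then show ?thesis
      by (simp add: \<phi>_def mult_ac)
  qed
  have "ball_integral r (\<lambda>x. (\<Sum>p\<in>UNIV. case_prod w p * \<phi> p x)\<^sup>2)
    = ball_integral r (\<lambda>_::'a. 1) * (r ^ 4 / ((DIM('a) + 2) * (DIM('a) + 4))) * (\<Sum>p\<in>UNIV. (case_prod w p)\<^sup>2)"
  proof (rule ball_integral_sq_sum_orthogonal)
    fix p :: "'i \<times> 'k"
    have "ball_integral r (\<lambda>x. (x \<bullet> e (fst p))\<^sup>2 * (x \<bullet> h (snd p))\<^sup>2)
      = ball_integral r (\<lambda>_::'a. 1) * (r ^ 4 / ((DIM('a) + 2) * (DIM('a) + 4)))"
      using e h disj \<open>r > 0\<close> by (intro ball_integral_sq_sq) auto
    then show "ball_integral r (\<lambda>x. (\<phi> p x)\<^sup>2)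
      = ball_integral r (\<lambda>_::'a. 1) * (r ^ 4 / ((DIM('a) + 2) * (DIM('a) + 4)))"
      by (simp add: \<phi>_def power_mult_distrib)
  qed (use orth in \<open>auto simp: \<phi>_def intro!: continuous_intros\<close>)
  then show ?thesis
    by (simp add: \<phi>_def UNIV_Times_UNIV[symmetric] sum.cartesian_product split_beta
        del: UNIV_Times_UNIV)
qed

subsection \<open>Matrices and cores\<close>

lemma norm_vec_sq: "(norm v)\<^sup>2 = (\<Sum>i\<in>UNIV. (norm (v $ i))\<^sup>2)"
  by (simp add: norm_vec_def L2_set_def sum_nonneg)

lemma norm_matrix_sq: "(norm (M :: real^'k^'m))\<^sup>2 = (\<Sum>i\<in>UNIV. \<Sum>k\<in>UNIV. (M $ i $ k)\<^sup>2)"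
  by (simp add: norm_vec_sq)

lemma matrix_mult_nth: "(A ** B) $ i $ k = (\<Sum>j\<in>UNIV. A $ i $ j * B $ j $ k)"
  by (simp add: matrix_matrix_mult_def)

lemma matrix_add_rdistrib: "(A + B) ** C = A ** C + B ** C"
  by (simp add: vec_eq_iff matrix_mult_nth distrib_right sum.distrib)

lemma continuous_on_matrix_mult:
  fixes f :: "'a::topological_space \<Rightarrow> real^'m^'p" and g :: "'a \<Rightarrow> real^'k^'m"
  assumes "continuous_on S f" and "continuous_on S g"
  shows "continuous_on S (\<lambda>x. f x ** g x)"
  unfolding matrix_matrix_mult_def using assms by (intro continuous_intros)

lemma norm_transpose: "norm (transpose M) = norm (M :: real^'k^'m)"
proof -
  have "(norm (transpose M))\<^sup>2 = (norm M)\<^sup>2"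
    unfolding norm_matrix_sq transpose_def by (simp, rule sum.swap)
  then show ?thesis
    by simp
qed

text \<open>The matrix \<open>U\<close> acts isometrically on vectors, hence on every column of
  \<open>M\<close>.\<close>

lemma norm_mult_orthonormal_columns:
  fixes U :: "real^'r^'m" and M :: "real^'k^'r"
  assumes "transpose U ** U = mat 1"
  shows "norm (U ** M) = norm M"
proof -
  have *: "norm (U *v x) = norm x" for x
  proof -
    have "(U *v x) \<bullet> (U *v x) = x \<bullet> ((transpose U ** U) *v x)"
      by (simp add: dot_lmul_matrix[symmetric] matrix_vector_mul_assoc[symmetric] inner_commute
          del: transpose_matrix_vector)
    then show ?thesis
      by (simp add: assms norm_eq_sqrt_inner)
  qed
  \<comment> \<open>A matrix is a vector of its rows; transposing makes the columns accessible as
    components.\<close>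
  have "norm (transpose (U ** M)) = norm (transpose M)"
  proof -
    have "(transpose (U ** M)) $ k = U *v (transpose M $ k)" for k
      by (simp add: vec_eq_iff transpose_def matrix_mult_nth matrix_vector_mult_def)
    then have "(norm (transpose (U ** M)))\<^sup>2 = (norm (transpose M))\<^sup>2"
      unfolding norm_vec_sq[of "transpose (U ** M)"] norm_vec_sq[of "transpose M"] by (simp add: *)
    then show ?thesis
      by simp
  qed
  then show ?thesis
    by (simp add: norm_transpose)
qed

lemma norm_mult_orthonormal_rows:
  fixes V :: "real^'k^'r" and M :: "real^'r^'m"
  assumes "V ** transpose V = mat 1"
  shows "norm (M ** V) = norm M"
  using norm_mult_orthonormal_columns[of "transpose V" "transpose M"] assms
  by (simp add: matrix_transpose_mul[symmetric] norm_transpose)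

section \<open>Unfoldings and isometry of orthonormal interfaces\<close>

lemma norm_left_unfolding: "norm (left_unfolding H) = norm (H :: real^'k^'m^'n)"
proof -
  have "(norm (left_unfolding H))\<^sup>2 = (\<Sum>p\<in>UNIV \<times> UNIV. (norm (H $ fst p $ snd p))\<^sup>2)"
    unfolding norm_vec_sq[of "left_unfolding H"] by (simp add: left_unfolding_def)
  also have "\<dots> = (norm H)\<^sup>2"
    by (simp add: norm_vec_sq[of H] norm_vec_sq[of "H $ _"] sum.cartesian_product split_beta)
  finally show ?thesis
    by simp
qed

lemma norm_right_unfolding: "norm (right_unfolding H) = norm (H :: real^'k^'m^'n)"
proof -
  have "(norm (right_unfolding H))\<^sup>2 = (\<Sum>i\<in>UNIV. \<Sum>p\<in>UNIV \<times> UNIV. (H $ fst p $ i $ snd p)\<^sup>2)"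
    by (simp add: norm_matrix_sq right_unfolding_def)
  also have "\<dots> = (\<Sum>i\<in>UNIV. \<Sum>j\<in>UNIV. \<Sum>k\<in>UNIV. (H $ j $ i $ k)\<^sup>2)"
    unfolding sum.cartesian_product by (simp add: split_beta)
  also have "\<dots> = (\<Sum>j\<in>UNIV. \<Sum>i\<in>UNIV. \<Sum>k\<in>UNIV. (H $ j $ i $ k)\<^sup>2)"
    by (rule sum.swap)
  also have "\<dots> = (norm H)\<^sup>2"
    by (simp add: norm_vec_sq[of H] norm_matrix_sq)
  finally show ?thesis
    by simp
qed

lemma right_unfolding_lmult: "right_unfolding (M *lc H) = M ** right_unfolding H"
  by (simp add: vec_eq_iff right_unfolding_def core_lmult_def matrix_mult_nth)

lemma left_unfolding_rmult: "left_unfolding (H *rc M) = left_unfolding H ** M"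
  by (simp add: vec_eq_iff left_unfolding_def core_rmult_def matrix_mult_nth)

text \<open>On right unfoldings, slicewise multiplication from the left is a plain matrix product,
  so orthonormal rows can be stripped off. This simplifies the summand of the domain that varies
  \<open>L\<close>; the mirror image below handles \<open>R\<close>.\<close>

lemma norm_lmult_orthonormal:
  assumes "right_unfolding H ** transpose (right_unfolding H) = mat 1"
  shows "norm (M *lc H) = norm M"
  unfolding norm_right_unfolding[symmetric, of "M *lc H"] right_unfolding_lmult
  using assms by (rule norm_mult_orthonormal_rows)

lemma norm_rmult_orthonormal:
  assumes "transpose (left_unfolding H) ** left_unfolding H = mat 1"
  shows "norm (H *rc M) = norm M"
  unfolding norm_left_unfolding[symmetric, of "H *rc M"] left_unfolding_rmult
  using assms by (rule norm_mult_orthonormal_columns)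

lemma norm_core_orthonormal:
  assumes "transpose L ** L = mat 1" and "R ** transpose R = mat 1"
  shows "norm (L *lc X *rc R) = norm X"
proof -
  have "(norm (L *lc X *rc R))\<^sup>2 = (norm X)\<^sup>2"
    unfolding norm_vec_sq[of "L *lc X *rc R"] norm_vec_sq[of X]
    by (simp add: core_lmult_def core_rmult_def norm_mult_orthonormal_columns[OF assms(1)]
        norm_mult_orthonormal_rows[OF assms(2)])
  then show ?thesis
    by simp
qed

text \<open>Since \<open>matrix_inv\<close> is defined by choice, an inverse is exhibited first and
  then identified by uniqueness. The explicit form shows that multiplication by the inverse only
  rescales matrix units.\<close>

lemma matrix_inv_diagonal:
  fixes \<Gamma> :: "real^'g^'g"
  assumes "\<forall>a b. a \<noteq> b \<longrightarrow> \<Gamma> $ a $ b = 0" and "\<forall>a. \<Gamma> $ a $ a > 0"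
  shows "matrix_inv \<Gamma> = (\<chi> a b. if a = b then inverse (\<Gamma> $ a $ a) else 0)"
    and "\<Gamma> ** matrix_inv \<Gamma> = mat 1" and "matrix_inv \<Gamma> ** \<Gamma> = mat 1"
proof -
  let ?G = "(\<chi> a b. if a = b then inverse (\<Gamma> $ a $ a) else 0) :: real^'g^'g"
  have nz: "\<Gamma> $ a $ a \<noteq> 0" for a
    using assms(2) by (metis less_irrefl)
  have "(\<Gamma> ** ?G) $ i $ k = \<Gamma> $ i $ k * inverse (\<Gamma> $ k $ k)"
    and "(?G ** \<Gamma>) $ i $ k = inverse (\<Gamma> $ i $ i) * \<Gamma> $ i $ k" for i k
    by (simp_all add: matrix_mult_nth if_distrib[of "\<lambda>x. _ * x"] if_distrib[of "\<lambda>x. x * _"] cong: if_cong)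
  then have 1: "\<Gamma> ** ?G = mat 1" "?G ** \<Gamma> = mat 1"
    using assms(1) nz by (auto simp: vec_eq_iff mat_def)
  have inv: "\<Gamma> ** matrix_inv \<Gamma> = mat 1 \<and> matrix_inv \<Gamma> ** \<Gamma> = mat 1"
    unfolding matrix_inv_def by (rule someI[of _ ?G]) (simp add: 1)
  then show "\<Gamma> ** matrix_inv \<Gamma> = mat 1" "matrix_inv \<Gamma> ** \<Gamma> = mat 1"
    by auto
  have "matrix_inv \<Gamma> = matrix_inv \<Gamma> ** (\<Gamma> ** ?G)"
    unfolding 1 by simp
  also have "\<dots> = ?G"
    unfolding matrix_mul_assoc using inv by simp
  finally show "matrix_inv \<Gamma> = ?G" .
qed

text \<open>Multilinear expansion into the parts of order 0, linear in \<open>U\<close>, linear in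
  \<open>V\<close>, and bilinear. An entry sees only row \<open>i\<close> of \<open>U\<close> and
  column \<open>k\<close> of \<open>V\<close>, and the coefficients are the entries that appear in
  the three regularization terms.\<close>

lemma matrix_mult_perturbed_nth:
  fixes L U :: "real^'g^'l" and X :: "real^'t^'g" and R V :: "real^'r^'t"
  shows "((L + s\<^sub>1 *\<^sub>R (U ** G)) ** X ** (R + s\<^sub>2 *\<^sub>R (H ** V))) $ i $ k
    = (L ** X ** R) $ i $ k
      + (\<Sum>a\<in>UNIV. (s\<^sub>1 * (G ** X ** R) $ a $ k) * U $ i $ a)
      + (\<Sum>b\<in>UNIV. (s\<^sub>2 * (L ** X ** H) $ i $ b) * V $ b $ k)
      + (\<Sum>a\<in>UNIV. \<Sum>b\<in>UNIV. (s\<^sub>1 * s\<^sub>2 * (G ** X ** H) $ a $ b) * (U $ i $ a * V $ b $ k))"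
proof -
  have "(L + s\<^sub>1 *\<^sub>R (U ** G)) ** X ** (R + s\<^sub>2 *\<^sub>R (H ** V))
    = L ** X ** R + s\<^sub>1 *\<^sub>R (U ** (G ** X ** R)) + s\<^sub>2 *\<^sub>R ((L ** X ** H) ** V)
      + (s\<^sub>1 * s\<^sub>2) *\<^sub>R (U ** (G ** X ** H) ** V)"
    by (simp add: matrix_add_ldistrib matrix_add_rdistrib scalar_matrix_assoc[symmetric]
        matrix_scalar_ac matrix_mul_assoc algebra_simps)
  moreover have "(U ** M ** V) $ i $ k = (\<Sum>a\<in>UNIV. \<Sum>b\<in>UNIV. M $ a $ b * (U $ i $ a * V $ b $ k))" for M
    unfolding matrix_mult_nth sum_distrib_right by (subst sum.swap) (simp add: mult_ac)
  moreover have "(U ** M) $ i $ k = (\<Sum>a\<in>UNIV. M $ a $ k * U $ i $ a)" for M :: "real^'r^'g"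
    by (simp add: matrix_mult_nth mult.commute)
  moreover have "(M ** V) $ i $ k = (\<Sum>b\<in>UNIV. M $ i $ b * V $ b $ k)" for M :: "real^'t^'l"
    by (simp add: matrix_mult_nth)
  ultimately show ?thesis
    by (simp add: sum_distrib_left mult.assoc)
qed

subsection \<open>The variational residual\<close>

type_synonym ('l, 'g, 'n, 't, 'r) variation = "(real^'g^'l) \<times> (real^'t^'g^'n) \<times> (real^'r^'t)"

lemma coordinate_reflection_uminus:
  "coordinate_reflection (\<lambda>(U, N, V). (- U, N, V))"
  "coordinate_reflection (\<lambda>(U, N, V). (U, - N, V))"
  "coordinate_reflection (\<lambda>(U, N, V). (U, N, - V))"
  by (auto simp: coordinate_reflection_def Basis_prod_def zero_prod_def intro!: linearI)

text \<open>One entry of the residual after the substitution. Parity in \<open>N\<close>,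
  \<open>U\<close> and \<open>V\<close> separates the five parts of the expansion, and the moment
  formulas evaluate those containing \<open>X\<close>. The last integral is free of \<open>X\<close>
  and is therefore left unevaluated.\<close>

lemma ball_integral_entry:
  fixes L :: "real^'g^'l" and G :: "real^'g^'g" and X :: "real^'t^'g" and H :: "real^'t^'t"
    and R :: "real^'r^'t" and j :: "'n::finite"
  assumes "\<omega> > 0" and D: "D = real DIM(('l, 'g, 'n, 't, 'r) variation)"
  shows "ball_integral \<omega> (\<lambda>(U, N, V). (((L + s\<^sub>1 *\<^sub>R (U ** G)) ** (X + N $ j) ** (R + s\<^sub>2 *\<^sub>R (H ** V))) $ i $ k - \<beta>)\<^sup>2)
    = ball_integral \<omega> (\<lambda>_::('l, 'g, 'n, 't, 'r) variation. 1)
        * (((L ** X ** R) $ i $ k - \<beta>)\<^sup>2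
           + s\<^sub>1\<^sup>2 * (\<omega>\<^sup>2 / (D + 2)) * (\<Sum>a\<in>UNIV. ((G ** X ** R) $ a $ k)\<^sup>2)
           + s\<^sub>2\<^sup>2 * (\<omega>\<^sup>2 / (D + 2)) * (\<Sum>b\<in>UNIV. ((L ** X ** H) $ i $ b)\<^sup>2)
           + s\<^sub>1\<^sup>2 * s\<^sub>2\<^sup>2 * (\<omega> ^ 4 / ((D + 2) * (D + 4))) * (norm (G ** X ** H))\<^sup>2)
      + ball_integral \<omega> (\<lambda>(U, N :: real^'t^'g^'n, V). (((L + s\<^sub>1 *\<^sub>R (U ** G)) ** N $ j ** (R + s\<^sub>2 *\<^sub>R (H ** V))) $ i $ k)\<^sup>2)"
proof -
  let ?vol = "ball_integral \<omega> (\<lambda>_::('l, 'g, 'n, 't, 'r) variation. 1)"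
  \<comment> \<open>\<open>e a\<close> and \<open>h b\<close> are the basis vectors that read off
    row \<open>i\<close> of \<open>U\<close> and column \<open>k\<close> of
    \<open>V\<close>.\<close>
  define e where "e = (\<lambda>a. (axis i (axis a 1), 0, 0) :: ('l, 'g, 'n, 't, 'r) variation)"
  define h where "h = (\<lambda>b. (0, 0, axis b (axis k 1)) :: ('l, 'g, 'n, 't, 'r) variation)"
  have "e a \<in> Basis" for a
    unfolding Basis_prod_def e_def
    by (rule UnI1, rule image_eqI[where x = "axis i (axis a 1)"]) (simp_all add: zero_prod_def)
  then have e: "inj e" "\<And>a. e a \<in> Basis" "\<And>x a. x \<bullet> e a = fst x $ i $ a"
    by (auto simp: e_def inj_def axis_eq_axis inner_prod_def inner_axis)
  have "h b \<in> Basis" for b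
    unfolding Basis_prod_def h_def
    by (rule UnI2, rule imageI, rule UnI2, rule imageI) simp
  then have h: "inj h" "\<And>b. h b \<in> Basis" "\<And>x b. x \<bullet> h b = snd (snd x) $ b $ k"
    by (auto simp: h_def inj_def axis_eq_axis inner_prod_def inner_axis)
  have eh: "e a \<noteq> h b" for a b
    by (auto simp: e_def h_def)
  define \<alpha> where "\<alpha> = (L ** X ** R) $ i $ k - \<beta>"
  define \<phi>\<^sub>1 where "\<phi>\<^sub>1 = (\<lambda>x. \<Sum>a\<in>UNIV. (s\<^sub>1 * (G ** X ** R) $ a $ k) * (x \<bullet> e a))"
  define \<phi>\<^sub>2 where "\<phi>\<^sub>2 = (\<lambda>x. \<Sum>b\<in>UNIV. (s\<^sub>2 * (L ** X ** H) $ i $ b) * (x \<bullet> h b))"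
  define \<phi>\<^sub>1\<^sub>2 where "\<phi>\<^sub>1\<^sub>2 = (\<lambda>x. \<Sum>a\<in>UNIV. \<Sum>b\<in>UNIV. (s\<^sub>1 * s\<^sub>2 * (G ** X ** H) $ a $ b) * ((x \<bullet> e a) * (x \<bullet> h b)))"
  define \<psi> where "\<psi> = (\<lambda>x :: ('l, 'g, 'n, 't, 'r) variation.
    ((L + s\<^sub>1 *\<^sub>R (fst x ** G)) ** fst (snd x) $ j ** (R + s\<^sub>2 *\<^sub>R (H ** snd (snd x)))) $ i $ k)"
  have c: "continuous_on UNIV \<phi>\<^sub>1" "continuous_on UNIV \<phi>\<^sub>2" "continuous_on UNIV \<phi>\<^sub>1\<^sub>2"
    unfolding \<phi>\<^sub>1_def \<phi>\<^sub>2_def \<phi>\<^sub>1\<^sub>2_def by (intro continuous_intros)+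
  have c': "continuous_on UNIV \<psi>"
    unfolding \<psi>_def matrix_mult_nth by (simp add: matrix_mult_nth) (intro continuous_intros)
  \<comment> \<open>The bracketing follows the order of separation: flipping \<open>N\<close>
    isolates \<open>\<psi>\<close>, flipping \<open>U\<close> separates the two inner sums, and
    flipping \<open>V\<close> splits each of these.\<close>
  have split: "(\<lambda>(U, N, V). (((L + s\<^sub>1 *\<^sub>R (U ** G)) ** (X + N $ j) ** (R + s\<^sub>2 *\<^sub>R (H ** V))) $ i $ k - \<beta>)\<^sup>2)
    = (\<lambda>x. (((\<alpha> + \<phi>\<^sub>2 x) + (\<phi>\<^sub>1 x + \<phi>\<^sub>1\<^sub>2 x)) + \<psi> x)\<^sup>2)"
  proof (intro ext, clarify)
    fix U :: "real^'g^'l" and N :: "real^'t^'g^'n" and V :: "real^'r^'t"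
    have "((L + s\<^sub>1 *\<^sub>R (U ** G)) ** (X + N $ j) ** (R + s\<^sub>2 *\<^sub>R (H ** V))) $ i $ k
      = ((L + s\<^sub>1 *\<^sub>R (U ** G)) ** X ** (R + s\<^sub>2 *\<^sub>R (H ** V))) $ i $ k + \<psi> (U, N, V)"
      by (simp add: \<psi>_def matrix_add_ldistrib matrix_add_rdistrib)
    also have "\<dots> = (L ** X ** R) $ i $ k + \<phi>\<^sub>1 (U, N, V) + \<phi>\<^sub>2 (U, N, V) + \<phi>\<^sub>1\<^sub>2 (U, N, V) + \<psi> (U, N, V)"
      unfolding matrix_mult_perturbed_nth by (simp add: \<phi>\<^sub>1_def \<phi>\<^sub>2_def \<phi>\<^sub>1\<^sub>2_def e(3) h(3))
    finally show "(((L + s\<^sub>1 *\<^sub>R (U ** G)) ** (X + N $ j) ** (R + s\<^sub>2 *\<^sub>R (H ** V))) $ i $ k - \<beta>)\<^sup>2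
      = (((\<alpha> + \<phi>\<^sub>2 (U, N, V)) + (\<phi>\<^sub>1 (U, N, V) + \<phi>\<^sub>1\<^sub>2 (U, N, V))) + \<psi> (U, N, V))\<^sup>2"
      by (simp add: \<alpha>_def algebra_simps)
  qed
  have \<psi>: "(\<lambda>(U, N, V). (((L + s\<^sub>1 *\<^sub>R (U ** G)) ** N $ j ** (R + s\<^sub>2 *\<^sub>R (H ** V))) $ i $ k)\<^sup>2)
    = (\<lambda>x. (\<psi> x)\<^sup>2)"
    by (auto simp: \<psi>_def)
  have "ball_integral \<omega> (\<lambda>x. (((\<alpha> + \<phi>\<^sub>2 x) + (\<phi>\<^sub>1 x + \<phi>\<^sub>1\<^sub>2 x)) + \<psi> x)\<^sup>2)
    = ball_integral \<omega> (\<lambda>x. ((\<alpha> + \<phi>\<^sub>2 x) + (\<phi>\<^sub>1 x + \<phi>\<^sub>1\<^sub>2 x))\<^sup>2) + ball_integral \<omega> (\<lambda>x. (\<psi> x)\<^sup>2)"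
    using c c'
    by (intro ball_integral_sq_add[OF coordinate_reflection_uminus(2)] continuous_intros)
       (auto simp: \<phi>\<^sub>1_def \<phi>\<^sub>2_def \<phi>\<^sub>1\<^sub>2_def e(3) h(3) \<psi>_def matrix_mult_nth sum_negf)
  also have "ball_integral \<omega> (\<lambda>x. ((\<alpha> + \<phi>\<^sub>2 x) + (\<phi>\<^sub>1 x + \<phi>\<^sub>1\<^sub>2 x))\<^sup>2)
    = ball_integral \<omega> (\<lambda>x. (\<alpha> + \<phi>\<^sub>2 x)\<^sup>2) + ball_integral \<omega> (\<lambda>x. (\<phi>\<^sub>1 x + \<phi>\<^sub>1\<^sub>2 x)\<^sup>2)"
    using c
    by (intro ball_integral_sq_add[OF coordinate_reflection_uminus(1)] continuous_intros)
       (auto simp: \<phi>\<^sub>1_def \<phi>\<^sub>2_def \<phi>\<^sub>1\<^sub>2_def e(3) h(3) sum_negf)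
  also have "ball_integral \<omega> (\<lambda>x. (\<alpha> + \<phi>\<^sub>2 x)\<^sup>2) = ball_integral \<omega> (\<lambda>x::('l, 'g, 'n, 't, 'r) variation. \<alpha>\<^sup>2) + ball_integral \<omega> (\<lambda>x. (\<phi>\<^sub>2 x)\<^sup>2)"
    using c
    by (intro ball_integral_sq_add[OF coordinate_reflection_uminus(3)] continuous_intros)
       (auto simp: \<phi>\<^sub>2_def h(3) sum_negf)
  also have "ball_integral \<omega> (\<lambda>x. (\<phi>\<^sub>1 x + \<phi>\<^sub>1\<^sub>2 x)\<^sup>2) = ball_integral \<omega> (\<lambda>x. (\<phi>\<^sub>1 x)\<^sup>2) + ball_integral \<omega> (\<lambda>x. (\<phi>\<^sub>1\<^sub>2 x)\<^sup>2)"
    using c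
    by (intro ball_integral_sq_add[OF coordinate_reflection_uminus(3)] continuous_intros)
       (auto simp: \<phi>\<^sub>1_def \<phi>\<^sub>1\<^sub>2_def e(3) h(3) sum_negf)
  also have "ball_integral \<omega> (\<lambda>x::('l, 'g, 'n, 't, 'r) variation. \<alpha>\<^sup>2) = ?vol * \<alpha>\<^sup>2"
    by (subst ball_integral_const) simp
  also have "ball_integral \<omega> (\<lambda>x. (\<phi>\<^sub>1 x)\<^sup>2) = ?vol * (\<omega>\<^sup>2 / (D + 2)) * (\<Sum>a\<in>UNIV. (s\<^sub>1 * (G ** X ** R) $ a $ k)\<^sup>2)"
    unfolding \<phi>\<^sub>1_def D ball_integral_linear_sq[OF e(1,2) assms(1)] by simp
  also have "ball_integral \<omega> (\<lambda>x. (\<phi>\<^sub>2 x)\<^sup>2) = ?vol * (\<omega>\<^sup>2 / (D + 2)) * (\<Sum>b\<in>UNIV. (s\<^sub>2 * (L ** X ** H) $ i $ b)\<^sup>2)"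
    unfolding \<phi>\<^sub>2_def D ball_integral_linear_sq[OF h(1,2) assms(1)] by simp
  also have "ball_integral \<omega> (\<lambda>x. (\<phi>\<^sub>1\<^sub>2 x)\<^sup>2)
    = ?vol * (\<omega> ^ 4 / ((D + 2) * (D + 4))) * (\<Sum>a\<in>UNIV. \<Sum>b\<in>UNIV. (s\<^sub>1 * s\<^sub>2 * (G ** X ** H) $ a $ b)\<^sup>2)"
    unfolding \<phi>\<^sub>1\<^sub>2_def D ball_integral_bilinear_sq[OF e(1) h(1) e(2) h(2) eh assms(1)]
    by (simp only: of_nat_mult of_nat_add of_nat_numeral)
  finally show ?thesis
    unfolding split \<psi> norm_matrix_sq \<alpha>_def[symmetric]
    by (simp add: power_mult_distrib sum_distrib_left[symmetric] distrib_left mult_ac)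
qed

text \<open>The domain becomes a ball under the diagonal substitution, and \<open>K\<close> is its
  Jacobian. As \<open>K\<close> is fixed before \<open>X\<close>, it does not affect the
  minimizers.\<close>

lemma variational_residual_ball:
  fixes L :: "real^'g^'l" and N :: "real^'t^'g^'n" and R :: "real^'r^'t" and A B :: "real^'r^'l^'n"
  assumes std: "standard_representation A L \<Gamma> N \<Theta> R" and "\<omega> > 0"
  shows "\<exists>K>0. \<forall>X. variational_residual \<omega> s\<^sub>1 s\<^sub>2 B S L (\<Gamma> *lc N *rc \<Theta>) R X
    = K * ball_integral \<omega> (\<lambda>(U, dN, V). \<Sum>(i, j, k)\<in>S.
        (((L + s\<^sub>1 *\<^sub>R (U ** matrix_inv \<Gamma>)) ** (X $ j + dN $ j) ** (R + s\<^sub>2 *\<^sub>R (matrix_inv \<Theta> ** V))) $ i $ k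
          - B $ j $ i $ k)\<^sup>2)"
proof -
  let ?G = "matrix_inv \<Gamma>" and ?H = "matrix_inv \<Theta>"
  have L: "transpose L ** L = mat 1" and R: "R ** transpose R = mat 1"
    and NR: "right_unfolding (N *rc \<Theta> *rc R) ** transpose (right_unfolding (N *rc \<Theta> *rc R)) = mat 1"
    and LN: "transpose (left_unfolding ((L ** \<Gamma>) *lc N)) ** left_unfolding ((L ** \<Gamma>) *lc N) = mat 1"
    and \<Gamma>: "\<forall>a b. a \<noteq> b \<longrightarrow> \<Gamma> $ a $ b = 0" "\<forall>a. \<Gamma> $ a $ a > 0"
    and \<Theta>: "\<forall>a b. a \<noteq> b \<longrightarrow> \<Theta> $ a $ b = 0" "\<forall>a. \<Theta> $ a $ a > 0"
    using std by (auto simp: standard_representation_def truncated_svd_def)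
  note G = matrix_inv_diagonal[OF \<Gamma>] and H = matrix_inv_diagonal[OF \<Theta>]
  define T where "T = (\<lambda>(U, dN, V). (U ** ?G, dN, ?H ** V) :: ('l, 'g, 'n, 't, 'r) variation)"
  define F where "F = (\<lambda>X (U, dN, V). \<Sum>(i, j, k)\<in>S.
    (((L + s\<^sub>1 *\<^sub>R U) ** (X $ j + dN $ j) ** (R + s\<^sub>2 *\<^sub>R V)) $ i $ k - B $ j $ i $ k)\<^sup>2)"
  define dom where "dom = variation_domain \<omega> L (\<Gamma> *lc N *rc \<Theta>) R"
  have dom: "dom = {x. (norm (fst x ** \<Gamma>))\<^sup>2 + (norm (fst (snd x)))\<^sup>2 + (norm (\<Theta> ** snd (snd x)))\<^sup>2 \<le> \<omega>\<^sup>2}"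
  proof -
    \<comment> \<open>Regrouping attaches \<open>\<Gamma>\<close> and \<open>\<Theta>\<close> to the
      variations, so that the remaining factors are exactly the interfaces with orthonormal
      unfoldings.\<close>
    have "dL *lc (\<Gamma> *lc N *rc \<Theta>) *rc R = (dL ** \<Gamma>) *lc (N *rc \<Theta> *rc R)" for dL :: "real^'g^'l"
      by (simp add: core_lmult_def core_rmult_def matrix_mul_assoc)
    moreover have "L *lc (\<Gamma> *lc N *rc \<Theta>) *rc dR = ((L ** \<Gamma>) *lc N) *rc (\<Theta> ** dR)" for dR :: "real^'r^'t"
      by (simp add: core_lmult_def core_rmult_def matrix_mul_assoc)
    ultimately show ?thesis
      unfolding dom_def variation_domain_def
      by (auto simp: norm_lmult_orthonormal[OF NR] norm_rmult_orthonormal[OF LN] norm_core_orthonormal[OF L R])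
  qed
  have "closed dom"
    unfolding dom by (intro closed_Collect_le continuous_intros continuous_on_matrix_mult)
  then have [measurable]: "dom \<in> sets borel"
    by (rule borel_closed)
  have F_cont: "continuous_on UNIV (F X)" for X
    unfolding F_def split_beta by (intro continuous_intros continuous_on_matrix_mult)
  then have [measurable]: "F X \<in> borel_measurable borel" for X
    by (rule borel_measurable_continuous_onI)
  \<comment> \<open>After \<open>\<Gamma>\<close> and \<open>\<Theta>\<close> cancel, the three
    squared norms add up to the squared norm of the product space.\<close>
  have T_dom: "indicator dom (T x) = (indicator (cball 0 \<omega>) x :: real)" for x
  proof -
    obtain U dN V where x: "x = (U, dN, V)"
      by (cases x)
    have "U ** ?G ** \<Gamma> = U" "\<Theta> ** (?H ** V) = V"
      using G H by (simp_all add: matrix_mul_assoc[of \<Theta>] matrix_mul_assoc[of U, symmetric])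
    then have "T x \<in> dom \<longleftrightarrow> (norm x)\<^sup>2 \<le> \<omega>\<^sup>2"
      unfolding dom x T_def by (simp add: norm_Pair add.assoc)
    then show ?thesis
      using \<open>\<omega> > 0\<close> by (simp add: indicator_def power2_le_iff_abs_le)
  qed
  have "linear T"
    unfolding T_def
    by (rule linearI) (auto simp: matrix_add_ldistrib matrix_add_rdistrib scalar_matrix_assoc matrix_scalar_ac)
  have T_basis: "\<exists>k. k \<noteq> 0 \<and> T b = k *\<^sub>R b" if b: "b \<in> Basis" for b
  proof -
    \<comment> \<open>The basis vectors of the matrix blocks are matrix units, which a diagonal
      factor multiplies by a single diagonal entry.\<close>
    have U: "axis i (axis a 1) ** ?G = inverse (\<Gamma> $ a $ a) *\<^sub>R axis i (axis a 1)" for i :: 'l and a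
      by (simp add: vec_eq_iff matrix_mult_nth G(1) axis_def if_distrib[of "\<lambda>x. _ * x"] if_distrib[of "\<lambda>x. x * _"]
          if_distrib[of "\<lambda>x. x $ _"] cong: if_cong)
    have V: "?H ** axis a (axis k 1) = inverse (\<Theta> $ a $ a) *\<^sub>R axis a (axis k 1)" for a and k :: 'r
      by (simp add: vec_eq_iff matrix_mult_nth H(1) axis_def if_distrib[of "\<lambda>x. _ * x"] if_distrib[of "\<lambda>x. x * _"]
          if_distrib[of "\<lambda>x. x $ _"] cong: if_cong)
    consider i a where "b = (axis i (axis a 1), 0, 0)" | u where "b = (0, u, 0)" | a k where "b = (0, 0, axis a (axis k 1))"
      using b by (auto simp: Basis_prod_def Basis_vec_def zero_prod_def)
    then show ?thesis
    proof cases
      case (1 i a)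
      then show ?thesis
        using \<Gamma>(2) by (intro exI[of _ "inverse (\<Gamma> $ a $ a)"]) (auto simp: T_def U less_imp_neq[symmetric])
    next
      case (2 u)
      then show ?thesis
        by (intro exI[of _ 1]) (auto simp: T_def)
    next
      case (3 a k)
      then show ?thesis
        using \<Theta>(2) by (intro exI[of _ "inverse (\<Theta> $ a $ a)"]) (auto simp: T_def V less_imp_neq[symmetric])
    qed
  qed
  define K where "K = (\<Prod>b\<in>(Basis :: ('l, 'g, 'n, 't, 'r) variation set). \<bar>T b \<bullet> b\<bar>)"
  have "K > 0"
    unfolding K_def
  proof (rule prod_pos)
    show "0 < \<bar>T b \<bullet> b\<bar>" if "b \<in> Basis" for b
      using T_basis[OF that] that by auto
  qed
  moreover have "variational_residual \<omega> s\<^sub>1 s\<^sub>2 B S L (\<Gamma> *lc N *rc \<Theta>) R X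
    = K * ball_integral \<omega> (\<lambda>x. F X (T x))" for X
  proof -
    have "variational_residual \<omega> s\<^sub>1 s\<^sub>2 B S L (\<Gamma> *lc N *rc \<Theta>) R X
      = (LINT x|lborel. indicator dom x * F X x)"
      unfolding variational_residual_def dom_def[symmetric] set_lebesgue_integral_def F_def core_seminorm_sq_def
      by (simp add: core_lmult_def core_rmult_def split_beta matrix_mul_assoc)
    also have "\<dots> = K * (LINT x|lborel. indicator dom (T x) * F X (T x))"
      unfolding K_def by (rule integral_lborel_diagonal[OF \<open>linear T\<close> T_basis]) auto
    finally show ?thesis
      by (simp add: T_dom ball_integral_def set_lebesgue_integral_def)
  qed
  moreover have "(\<lambda>x. F X (T x)) = (\<lambda>(U, dN, V). \<Sum>(i, j, k)\<in>S.
        (((L + s\<^sub>1 *\<^sub>R (U ** ?G)) ** (X $ j + dN $ j) ** (R + s\<^sub>2 *\<^sub>R (?H ** V))) $ i $ k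
          - B $ j $ i $ k)\<^sup>2)" for X
    by (auto simp: F_def T_def)
  ultimately show ?thesis
    by auto
qed

text \<open>Keeping repeated columns and rows means one summand for every position in
  \<open>P\<close>, even if it depends on only one index; the factor \<open>card P\<close> likewise
  becomes a sum of equal terms. The enumeration thereby disappears, and each entry of the residual
  has its own share of the regularizer.\<close>

lemma regularizer_eq_sum:
  fixes L :: "real^'g^'l" and \<Gamma> :: "real^'g^'g" and \<Theta> :: "real^'t^'t" and R :: "real^'r^'t"
  assumes xs: "distinct xs" "set xs = P"
  shows "regularizer \<omega> \<zeta>\<^sub>1 \<zeta>\<^sub>2 \<zeta>\<^sub>1\<^sub>2 L \<Gamma> \<Theta> R P xs X = (\<Sum>(i, k)\<in>P.
      inverse (real CARD('l)) * \<zeta>\<^sub>1 * \<omega>\<^sup>2 * (\<Sum>a\<in>UNIV. ((matrix_inv \<Gamma> ** X ** R) $ a $ k)\<^sup>2)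
    + inverse (real CARD('r)) * \<zeta>\<^sub>2 * \<omega>\<^sup>2 * (\<Sum>b\<in>UNIV. ((L ** X ** matrix_inv \<Theta>) $ i $ b)\<^sup>2)
    + inverse (real CARD('r) * real CARD('l)) * \<zeta>\<^sub>1\<^sub>2 * \<omega> ^ 4 * (norm (matrix_inv \<Gamma> ** X ** matrix_inv \<Theta>))\<^sup>2)"
proof -
  have "(norm (M *v column k R))\<^sup>2 = (\<Sum>a\<in>UNIV. ((M ** R) $ a $ k)\<^sup>2)" for M :: "real^'t^'g" and k
    by (simp add: norm_vec_sq matrix_vector_mult_def matrix_mult_nth column_def)
  then have cols: "list_frobenius_sq (mult_columns (matrix_inv \<Gamma> ** X) (select_columns R (map snd xs)))
    = (\<Sum>(i, k)\<in>P. \<Sum>a\<in>UNIV. ((matrix_inv \<Gamma> ** X ** R) $ a $ k)\<^sup>2)"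
    using xs by (simp add: list_frobenius_sq_def mult_columns_def select_columns_def o_def split_beta
        sum_list_distinct_conv_sum_set)
  have "(norm (row i L v* M))\<^sup>2 = (\<Sum>b\<in>UNIV. ((L ** M) $ i $ b)\<^sup>2)" for M :: "real^'t^'g" and i
    by (simp add: norm_vec_sq vector_matrix_mult_def matrix_mult_nth row_def mult.commute)
  then have rows: "list_frobenius_sq (mult_rows (select_rows L (map fst xs)) (X ** matrix_inv \<Theta>))
    = (\<Sum>(i, k)\<in>P. \<Sum>b\<in>UNIV. ((L ** X ** matrix_inv \<Theta>) $ i $ b)\<^sup>2)"
    using xs by (simp add: list_frobenius_sq_def mult_rows_def select_rows_def o_def split_beta
        sum_list_distinct_conv_sum_set matrix_mul_assoc)
  show ?thesis
    unfolding regularizer_def cols rows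
    by (simp add: split_beta sum.distrib sum_distrib_left)
qed

lemma sum_slices:
  fixes f :: "'l::finite \<Rightarrow> 'n::finite \<Rightarrow> 'r::finite \<Rightarrow> real"
  shows "(\<Sum>(i, j, k)\<in>S. f i j k) = (\<Sum>j\<in>UNIV. \<Sum>(i, k)\<in>slice S j. f i j k)"
proof -
  have "(\<Sum>(i, j, k)\<in>S. f i j k) = (\<Sum>(j, i, k)\<in>Sigma UNIV (slice S). f i j k)"
    by (rule sum.reindex_bij_witness[of _ "\<lambda>(j, i, k). (i, j, k)" "\<lambda>(i, j, k). (j, i, k)"])
       (auto simp: slice_def)
  then show ?thesis
    by (simp add: sum.Sigma split_beta)
qed

text \<open>The entry formula is summed over \<open>S\<close> and regrouped by slices.
  \<open>K\<close> collects the Jacobian and the volume of the ball, \<open>C\<close> the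
  contribution of \<open>dN\<close>; neither depends on \<open>X\<close>.\<close>

lemma variational_residual_eq:
  fixes L :: "real^'g^'l" and N :: "real^'t^'g^'n" and R :: "real^'r^'t" and A B :: "real^'r^'l^'n"
    and D \<zeta>\<^sub>1 \<zeta>\<^sub>2 \<zeta>\<^sub>1\<^sub>2 :: real
  assumes std: "standard_representation A L \<Gamma> N \<Theta> R" and "\<omega> > 0"
    and xs: "\<forall>j. distinct (xs j) \<and> set (xs j) = slice S j"
    and D: "D = real CARD('l) * real CARD('g) + real CARD('g) * real CARD('n) * real CARD('t)
      + real CARD('t) * real CARD('r)"
    and \<zeta>: "\<zeta>\<^sub>1 = s\<^sub>1\<^sup>2 * (real CARD('l) / (D + 2))" "\<zeta>\<^sub>2 = s\<^sub>2\<^sup>2 * (real CARD('r) / (D + 2))"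
      "\<zeta>\<^sub>1\<^sub>2 = s\<^sub>1\<^sup>2 * s\<^sub>2\<^sup>2 * (real CARD('r) * real CARD('l) / ((D + 2) * (D + 4)))"
  shows "\<exists>K C. K > 0 \<and> (\<forall>X. variational_residual \<omega> s\<^sub>1 s\<^sub>2 B S L (\<Gamma> *lc N *rc \<Theta>) R X
    = K * (\<Sum>j\<in>UNIV. matrix_seminorm_sq (slice S j) (L ** X $ j ** R - B $ j)
        + regularizer \<omega> \<zeta>\<^sub>1 \<zeta>\<^sub>2 \<zeta>\<^sub>1\<^sub>2 L \<Gamma> \<Theta> R (slice S j) (xs j) (X $ j)) + C)"
proof -
  let ?G = "matrix_inv \<Gamma>" and ?H = "matrix_inv \<Theta>"
  let ?vol = "ball_integral \<omega> (\<lambda>_::('l, 'g, 'n, 't, 'r) variation. 1)"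
  obtain K where K: "K > 0" "\<And>X. variational_residual \<omega> s\<^sub>1 s\<^sub>2 B S L (\<Gamma> *lc N *rc \<Theta>) R X
    = K * ball_integral \<omega> (\<lambda>(U, dN, V). \<Sum>(i, j, k)\<in>S.
        (((L + s\<^sub>1 *\<^sub>R (U ** ?G)) ** (X $ j + dN $ j) ** (R + s\<^sub>2 *\<^sub>R (?H ** V))) $ i $ k
          - B $ j $ i $ k)\<^sup>2)"
    using variational_residual_ball[OF std \<open>\<omega> > 0\<close>, where s\<^sub>1 = s\<^sub>1 and s\<^sub>2 = s\<^sub>2 and B = B and S = S]
    by (elim exE conjE) (rule that, blast+)
  define f where "f = (\<lambda>X (i, j, k) (U :: real^'g^'l, dN :: real^'t^'g^'n, V :: real^'r^'t).
    (((L + s\<^sub>1 *\<^sub>R (U ** ?G)) ** (X $ j + dN $ j) ** (R + s\<^sub>2 *\<^sub>R (?H ** V))) $ i $ k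
          - B $ j $ i $ k)\<^sup>2)"
  have cont: "continuous_on UNIV (f X p)" for X p
    unfolding f_def split_beta by (intro continuous_intros continuous_on_matrix_mult)
  define c where "c = (\<lambda>(i, j, k). ball_integral \<omega> (\<lambda>(U, dN :: real^'t^'g^'n, V).
    (((L + s\<^sub>1 *\<^sub>R (U ** ?G)) ** dN $ j ** (R + s\<^sub>2 *\<^sub>R (?H ** V))) $ i $ k)\<^sup>2))"
  define q where "q = (\<lambda>X i j k. (L ** X $ j ** R - B $ j) $ i $ k ^ 2
    + (inverse (real CARD('l)) * \<zeta>\<^sub>1 * \<omega>\<^sup>2 * (\<Sum>a\<in>UNIV. ((?G ** X $ j ** R) $ a $ k)\<^sup>2)
    + inverse (real CARD('r)) * \<zeta>\<^sub>2 * \<omega>\<^sup>2 * (\<Sum>b\<in>UNIV. ((L ** X $ j ** ?H) $ i $ b)\<^sup>2)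
    + inverse (real CARD('r) * real CARD('l)) * \<zeta>\<^sub>1\<^sub>2 * \<omega> ^ 4 * (norm (?G ** X $ j ** ?H))\<^sup>2))"
  have DIM: "real DIM(('l, 'g, 'n, 't, 'r) variation) = D"
    by (simp add: D mult_ac)
  \<comment> \<open>The factors \<open>1 / n_L\<close> and \<open>1 / n_R\<close> of the regularizer
    cancel against the constants, leaving the bare weights of the moment formulas.\<close>
  have weights: "inverse (real CARD('l)) * \<zeta>\<^sub>1 = s\<^sub>1\<^sup>2 / (D + 2)"
    "inverse (real CARD('r)) * \<zeta>\<^sub>2 = s\<^sub>2\<^sup>2 / (D + 2)"
    "inverse (real CARD('r) * real CARD('l)) * \<zeta>\<^sub>1\<^sub>2 = s\<^sub>1\<^sup>2 * s\<^sub>2\<^sup>2 / ((D + 2) * (D + 4))"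
    unfolding \<zeta> by (simp_all add: inverse_eq_divide)
  have f_int: "ball_integral \<omega> (f X (i, j, k)) = ?vol * q X i j k + c (i, j, k)" for X i j k
    unfolding f_def prod.case ball_integral_entry[OF \<open>\<omega> > 0\<close> DIM[symmetric]] q_def c_def weights
    by (simp add: add.assoc)
  have q_sum: "(\<Sum>(i, j, k)\<in>S. q X i j k)
    = (\<Sum>j\<in>UNIV. matrix_seminorm_sq (slice S j) (L ** X $ j ** R - B $ j)
        + regularizer \<omega> \<zeta>\<^sub>1 \<zeta>\<^sub>2 \<zeta>\<^sub>1\<^sub>2 L \<Gamma> \<Theta> R (slice S j) (xs j) (X $ j))" for X
  proof -
    have "matrix_seminorm_sq (slice S j) (L ** X $ j ** R - B $ j)
        + regularizer \<omega> \<zeta>\<^sub>1 \<zeta>\<^sub>2 \<zeta>\<^sub>1\<^sub>2 L \<Gamma> \<Theta> R (slice S j) (xs j) (X $ j)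
        = (\<Sum>(i, k)\<in>slice S j. q X i j k)" for j
      using xs by (subst regularizer_eq_sum) (auto simp: q_def matrix_seminorm_sq_def split_beta sum.distrib)
    then show ?thesis
      by (simp add: sum_slices)
  qed
  have "variational_residual \<omega> s\<^sub>1 s\<^sub>2 B S L (\<Gamma> *lc N *rc \<Theta>) R X
    = (K * ?vol) * (\<Sum>(i, j, k)\<in>S. q X i j k) + K * (\<Sum>p\<in>S. c p)" for X
  proof -
    have "variational_residual \<omega> s\<^sub>1 s\<^sub>2 B S L (\<Gamma> *lc N *rc \<Theta>) R X
      = K * ball_integral \<omega> (\<lambda>x. \<Sum>p\<in>S. f X p x)"
      unfolding K by (intro arg_cong[where f = "\<lambda>g. K * ball_integral \<omega> g"]) (auto simp: f_def split_beta)
    also have "\<dots> = K * (\<Sum>p\<in>S. ball_integral \<omega> (f X p))"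
      by (subst ball_integral_sum) (auto intro: cont)
    also have "(\<Sum>p\<in>S. ball_integral \<omega> (f X p)) = (\<Sum>p\<in>S. ?vol * (case p of (i, j, k) \<Rightarrow> q X i j k) + c p)"
      by (intro sum.cong) (auto simp: f_int)
    finally show ?thesis
      by (simp add: sum.distrib sum_distrib_left[symmetric] distrib_left)
  qed
  moreover have "K * ?vol > 0"
    using K(1) ball_integral_1_pos[OF \<open>\<omega> > 0\<close>] by (rule mult_pos_pos)
  ultimately show ?thesis
    unfolding q_sum by blast
qed

subsection \<open>Minimizers\<close>

text \<open>Minimizers depend only on the strict order of values, so increasing affine changes, and
  squaring a nonnegative objective, are harmless.\<close>

lemma is_arg_min_cong_less:
  assumes "\<And>x y. f x < f y \<longleftrightarrow> g x < g y"
  shows "is_arg_min f P = is_arg_min g P"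
  using assms by (auto simp: is_arg_min_def fun_eq_iff)

text \<open>Components can be varied independently because both the objective and the constraint
  separate.\<close>

lemma is_arg_min_sum:
  fixes f :: "'n::finite \<Rightarrow> 'a \<Rightarrow> real"
  shows "is_arg_min (\<lambda>X. \<Sum>j\<in>UNIV. f j (X $ j)) (\<lambda>X. \<forall>j. P j (X $ j)) X
    \<longleftrightarrow> (\<forall>j. is_arg_min (f j) (P j) (X $ j))"
proof
  assume X: "is_arg_min (\<lambda>X. \<Sum>j\<in>UNIV. f j (X $ j)) (\<lambda>X. \<forall>j. P j (X $ j)) X"
  show "\<forall>j. is_arg_min (f j) (P j) (X $ j)"
  proof
    fix j
    have "f j (X $ j) \<le> f j y" if "P j y" for y
    proof -
      \<comment> \<open>The competitor alters component \<open>j\<close> only; all other summands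
        cancel in the comparison.\<close>
      define Y where "Y = (\<chi> i. if i = j then y else X $ i)"
      have "\<forall>i. P i (Y $ i)"
        using X that by (simp add: is_arg_min_linorder Y_def)
      then have "(\<Sum>i\<in>UNIV. f i (X $ i)) \<le> (\<Sum>i\<in>UNIV. f i (Y $ i))"
        using X by (simp add: is_arg_min_linorder)
      moreover have "(\<Sum>i\<in>UNIV - {j}. f i (Y $ i)) = (\<Sum>i\<in>UNIV - {j}. f i (X $ i))"
        by (intro sum.cong) (auto simp: Y_def)
      ultimately show ?thesis
        by (simp add: sum.remove[of UNIV j] Y_def)
    qed
    then show "is_arg_min (f j) (P j) (X $ j)"
      using X by (auto simp: is_arg_min_linorder)
  qed
next
  assume "\<forall>j. is_arg_min (f j) (P j) (X $ j)"
  then show "is_arg_min (\<lambda>X. \<Sum>j\<in>UNIV. f j (X $ j)) (\<lambda>X. \<forall>j. P j (X $ j)) X"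
    by (auto simp: is_arg_min_linorder intro!: sum_mono)
qed

text \<open>The minimizers of a separable sum form a product set, so the tie-break is again a
  separable problem. Requiring only the same order as the sums admits the affine form of the
  residual and the unsquared norm.\<close>

lemma is_arg_min_tiebreak_sum:
  fixes f g :: "'n::finite \<Rightarrow> 'a \<Rightarrow> real"
  assumes F: "\<And>X Y. F X < F Y \<longleftrightarrow> (\<Sum>j\<in>UNIV. f j (X $ j)) < (\<Sum>j\<in>UNIV. f j (Y $ j))"
    and G: "\<And>X Y. G X < G Y \<longleftrightarrow> (\<Sum>j\<in>UNIV. g j (X $ j)) < (\<Sum>j\<in>UNIV. g j (Y $ j))"
  shows "is_arg_min_tiebreak F G X \<longleftrightarrow> (\<forall>j. is_arg_min_tiebreak (f j) (g j) (X $ j))"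
proof -
  have "is_arg_min F (\<lambda>_. True) = (\<lambda>X. \<forall>j. is_arg_min (f j) (\<lambda>_. True) (X $ j))"
    using is_arg_min_sum[of f "\<lambda>_ _. True"]
    by (simp add: fun_eq_iff is_arg_min_cong_less[where f = F, OF F])
  then show ?thesis
    unfolding is_arg_min_tiebreak_def using is_arg_min_sum[of g "\<lambda>j. is_arg_min (f j) (\<lambda>_. True)"]
    by (simp add: is_arg_min_cong_less[where f = G, OF G])
qed

text \<open>A tie-break has no choice on a singleton.\<close>

lemma ex1_is_arg_min_tiebreakI:
  assumes "\<exists>!x. is_arg_min f (\<lambda>_. True) x"
  shows "\<exists>!x. is_arg_min_tiebreak f g x"
  using assms unfolding is_arg_min_tiebreak_def is_arg_min_def[of g] by (metis less_irrefl)

text \<open>The midpoint inequality against 0 forces quadratic growth, so a minimum over a ball is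
  global. The midpoint of two different minimizers would have a strictly smaller value.\<close>

lemma ex1_arg_min_strongly_midpoint_convex:
  fixes f :: "'a::euclidean_space \<Rightarrow> real"
  assumes cont: "continuous_on UNIV f" and nonneg: "\<And>x. f x \<ge> 0" and "c > 0"
    and mid: "\<And>x y. f ((1 / 2) *\<^sub>R (x + y)) \<le> (f x + f y) / 2 - c * (norm (x - y))\<^sup>2"
  shows "\<exists>!x. is_arg_min f (\<lambda>_. True) x"
proof -
  have growth: "f x \<ge> 2 * c * (norm x)\<^sup>2 - f 0" for x
    using order_trans[OF nonneg mid[of x 0]] by simp
  \<comment> \<open>This radius makes the lower bound \<open>2 * c * \<rho>\<^sup>2 - f 0\<close>
    equal to \<open>f 0\<close>, so no point outside the ball lies below the value at the
    centre.\<close>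
  define \<rho> where "\<rho> = sqrt (f 0 / c)"
  have \<rho>: "\<rho> \<ge> 0" "c * \<rho>\<^sup>2 = f 0"
    using \<open>c > 0\<close> nonneg[of 0] by (auto simp: \<rho>_def)
  obtain x where x: "x \<in> cball 0 \<rho>" "\<And>y. y \<in> cball 0 \<rho> \<Longrightarrow> f x \<le> f y"
    using continuous_attains_inf[of "cball 0 \<rho>" f] \<rho>(1) continuous_on_subset[OF cont subset_UNIV]
    by auto
  have "f x \<le> f y" for y
  proof (cases "norm y \<le> \<rho>")
    case False
    then have "\<rho>\<^sup>2 \<le> (norm y)\<^sup>2"
      using \<rho>(1) by (intro power_mono) auto
    then have "c * \<rho>\<^sup>2 \<le> c * (norm y)\<^sup>2"
      using \<open>c > 0\<close> by (intro mult_left_mono) auto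
    then have "f 0 \<le> f y"
      using growth[of y] \<rho>(2) by linarith
    moreover have "f x \<le> f 0"
      using x(2)[of 0] \<rho>(1) by simp
    ultimately show ?thesis
      by simp
  qed (use x(2) in simp)
  then have "is_arg_min f (\<lambda>_. True) x"
    by (simp add: is_arg_min_linorder)
  moreover have "y = z" if "is_arg_min f (\<lambda>_. True) y" "is_arg_min f (\<lambda>_. True) z" for y z
  proof -
    have "f y = f z" "f y \<le> f ((1 / 2) *\<^sub>R (y + z))"
      using that by (auto simp: is_arg_min_linorder intro: antisym)
    then have "c * (norm (y - z))\<^sup>2 \<le> 0"
      using mid[of y z] by simp
    then show ?thesis
      using \<open>c > 0\<close> by (simp add: mult_le_0_iff)
  qed
  ultimately show ?thesis
    by blast
qed

text \<open>The law is put in midpoint form, with \<open>h (x - y) / 4\<close> as the exact defect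
  of midpoint convexity. In this form it needs no separate homogeneity and is stable under linear
  combinations.\<close>

definition parallelogram_law :: "('a::real_vector \<Rightarrow> real) \<Rightarrow> bool" where
  "parallelogram_law h \<longleftrightarrow> (\<forall>x y. h ((1 / 2) *\<^sub>R (x + y)) = (h x + h y) / 2 - h (x - y) / 4)"

lemma parallelogram_law_linear:
  fixes f :: "'a::real_vector \<Rightarrow> 'b::real_inner"
  assumes "linear f"
  shows "parallelogram_law (\<lambda>x. (norm (f x))\<^sup>2)"
proof -
  have "(norm ((1 / 2) *\<^sub>R (u + v)))\<^sup>2 = ((norm u)\<^sup>2 + (norm v)\<^sup>2) / 2 - (norm (u - v))\<^sup>2 / 4" for u v :: 'b
    by (simp add: power2_norm_eq_inner inner_simps inner_commute field_simps)
  then show ?thesis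
    by (simp add: parallelogram_law_def linear_scale[OF assms] linear_add[OF assms] linear_diff[OF assms])
qed

lemma parallelogram_law_add:
  "parallelogram_law f \<Longrightarrow> parallelogram_law g \<Longrightarrow> parallelogram_law (\<lambda>x. f x + g x)"
  by (simp add: parallelogram_law_def add_divide_distrib)

lemma parallelogram_law_cmult: "parallelogram_law f \<Longrightarrow> parallelogram_law (\<lambda>x. c * f x)"
  by (simp add: parallelogram_law_def right_diff_distrib distrib_left add_divide_distrib)

lemma parallelogram_law_sum:
  "(\<And>i. i \<in> I \<Longrightarrow> parallelogram_law (f i)) \<Longrightarrow> parallelogram_law (\<lambda>x. \<Sum>i\<in>I. f i x)"
  by (simp add: parallelogram_law_def sum.distrib sum_subtractf sum_divide_distrib[symmetric])

lemma parallelogram_law_linear_sq: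
  fixes f :: "'a::real_vector \<Rightarrow> real"
  assumes "linear f"
  shows "parallelogram_law (\<lambda>x. (f x)\<^sup>2)"
  using parallelogram_law_linear[OF assms] by simp

lemma linear_matrix_sandwich: "linear (\<lambda>X. M ** X ** M' :: real^'k^'m)"
  by (rule linearI) (simp_all add: matrix_add_ldistrib matrix_add_rdistrib scalar_matrix_assoc matrix_scalar_ac)

lemma linear_matrix_sandwich_nth: "linear (\<lambda>X. (M ** X ** M' :: real^'k^'m) $ i $ k)"
  using linear_matrix_sandwich[of M M'] by (simp add: linear_iff)

lemma parallelogram_law_regularizer:
  assumes "distinct xs" "set xs = P"
  shows "parallelogram_law (regularizer \<omega> \<zeta>\<^sub>1 \<zeta>\<^sub>2 \<zeta>\<^sub>1\<^sub>2 L \<Gamma> \<Theta> R P xs)"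
  unfolding regularizer_eq_sum[OF assms, abs_def] split_beta
  by (intro parallelogram_law_sum parallelogram_law_add parallelogram_law_cmult
      parallelogram_law_linear_sq parallelogram_law_linear linear_matrix_sandwich_nth linear_matrix_sandwich)

lemma list_frobenius_sq_nonneg: "list_frobenius_sq vs \<ge> 0"
  unfolding list_frobenius_sq_def by (rule sum_list_nonneg) auto

text \<open>The first two terms see \<open>X\<close> only through selected columns of
  \<open>R\<close> or rows of \<open>L\<close>, so coercivity is drawn from the last term.\<close>

lemma regularizer_ge:
  fixes L :: "real^'g^'l" and R :: "real^'r^'t"
  assumes "\<zeta>\<^sub>1 \<ge> 0" "\<zeta>\<^sub>2 \<ge> 0"
  shows "regularizer \<omega> \<zeta>\<^sub>1 \<zeta>\<^sub>2 \<zeta>\<^sub>1\<^sub>2 L \<Gamma> \<Theta> R P xs X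
    \<ge> real (card P) * inverse (real CARD('r) * real CARD('l)) * \<zeta>\<^sub>1\<^sub>2 * \<omega> ^ 4
        * (norm (matrix_inv \<Gamma> ** X ** matrix_inv \<Theta>))\<^sup>2"
  using assms by (simp add: regularizer_def list_frobenius_sq_nonneg)

text \<open>For empty \<open>P\<close> every \<open>X\<close> has value 0 and the tie-break, which
  equals \<open>norm X\<close>, selects 0. Otherwise the last regularization term has positive
  weight and yields strong convexity.\<close>

lemma ex1_slice_minimizer:
  fixes L :: "real^'g^'l" and \<Gamma> :: "real^'g^'g" and \<Theta> :: "real^'t^'t" and R :: "real^'r^'t"
  assumes orth: "transpose L ** L = mat 1" "R ** transpose R = mat 1"
    and \<Gamma>: "\<Gamma> ** matrix_inv \<Gamma> = mat 1" and \<Theta>: "matrix_inv \<Theta> ** \<Theta> = mat 1"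
    and xs: "distinct xs" "set xs = P"
    and "\<omega> > 0" and \<zeta>: "\<zeta>\<^sub>1 \<ge> 0" "\<zeta>\<^sub>2 \<ge> 0" "\<zeta>\<^sub>1\<^sub>2 > 0"
  shows "\<exists>!X. is_arg_min_tiebreak
    (\<lambda>X. matrix_seminorm_sq P (L ** X ** R - B) + regularizer \<omega> \<zeta>\<^sub>1 \<zeta>\<^sub>2 \<zeta>\<^sub>1\<^sub>2 L \<Gamma> \<Theta> R P xs X)
    (\<lambda>X. norm (L ** X ** R)) X"
proof (cases "P = {}")
  case True
  then have "xs = []"
    using xs by simp
  have norm_eq: "norm (L ** X ** R) = norm X" for X
    by (simp add: norm_mult_orthonormal_rows[OF orth(2)] norm_mult_orthonormal_columns[OF orth(1)])
  have "is_arg_min_tiebreak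
    (\<lambda>X. matrix_seminorm_sq P (L ** X ** R - B) + regularizer \<omega> \<zeta>\<^sub>1 \<zeta>\<^sub>2 \<zeta>\<^sub>1\<^sub>2 L \<Gamma> \<Theta> R P xs X)
    (\<lambda>X. norm (L ** X ** R)) X \<longleftrightarrow> X = 0" for X
    by (auto simp: True \<open>xs = []\<close> is_arg_min_tiebreak_def is_arg_min_linorder matrix_seminorm_sq_def
        regularizer_def list_frobenius_sq_def mult_columns_def select_columns_def
        mult_rows_def select_rows_def norm_eq dest: spec[of _ 0])
  then show ?thesis
    by simp
next
  case False
  let ?G = "matrix_inv \<Gamma>" and ?H = "matrix_inv \<Theta>"
  let ?reg = "regularizer \<omega> \<zeta>\<^sub>1 \<zeta>\<^sub>2 \<zeta>\<^sub>1\<^sub>2 L \<Gamma> \<Theta> R P xs"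
  define f where "f = (\<lambda>X. matrix_seminorm_sq P (L ** X ** R - B) + ?reg X)"
  define w where "w = real (card P) * inverse (real CARD('r) * real CARD('l)) * \<zeta>\<^sub>1\<^sub>2 * \<omega> ^ 4"
  have "w > 0"
    using False \<zeta> \<open>\<omega> > 0\<close> by (simp add: w_def card_gt_0_iff)
  have reg_ge: "?reg X \<ge> w * (norm (?G ** X ** ?H))\<^sup>2" for X
    unfolding w_def using \<zeta> by (intro regularizer_ge)
  have reg_nonneg: "?reg X \<ge> 0" for X
    using reg_ge[of X] \<open>w > 0\<close> by (meson order_trans mult_nonneg_nonneg less_imp_le zero_le_power2)
  have semi_nonneg: "matrix_seminorm_sq P M \<ge> 0" for M
    unfolding matrix_seminorm_sq_def by (auto intro!: sum_nonneg)
  \<comment> \<open>This bounds the inverse of the map \<open>X\<close> to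
    \<open>?G ** X ** ?H\<close>, which converts the last regularization term into a multiple of
    \<open>(norm X)\<^sup>2\<close>.\<close>
  obtain b where "b > 0" and b: "norm (\<Gamma> ** M ** \<Theta>) \<le> b * norm M" for M
    using linear_bounded_pos[OF linear_matrix_sandwich[of \<Gamma> \<Theta>]] by auto
  define \<kappa> where "\<kappa> = w / b\<^sup>2"
  have "\<kappa> > 0"
    using \<open>w > 0\<close> \<open>b > 0\<close> by (simp add: \<kappa>_def)
  have lower: "?reg X \<ge> \<kappa> * (norm X)\<^sup>2" for X
  proof -
    have "\<Gamma> ** (?G ** X ** ?H) ** \<Theta> = (\<Gamma> ** ?G) ** X ** (?H ** \<Theta>)"
      by (simp only: matrix_mul_assoc)
    then have "norm X \<le> b * norm (?G ** X ** ?H)"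
      using b[of "?G ** X ** ?H"] by (simp add: \<Gamma> \<Theta>)
    then have "(norm X)\<^sup>2 \<le> b\<^sup>2 * (norm (?G ** X ** ?H))\<^sup>2"
      by (metis norm_ge_zero power_mono power_mult_distrib)
    then have "w * (norm X)\<^sup>2 \<le> w * (b\<^sup>2 * (norm (?G ** X ** ?H))\<^sup>2)"
      using \<open>w > 0\<close> by (intro mult_left_mono) auto
    then have "\<kappa> * (norm X)\<^sup>2 \<le> w * (norm (?G ** X ** ?H))\<^sup>2"
      using \<open>b > 0\<close> by (simp add: \<kappa>_def field_simps)
    then show ?thesis
      using reg_ge[of X] by linarith
  qed
  have "\<exists>!X. is_arg_min f (\<lambda>_. True) X"
  proof (rule ex1_arg_min_strongly_midpoint_convex)
    show "continuous_on UNIV f"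
      unfolding f_def regularizer_eq_sum[OF xs] matrix_seminorm_sq_def split_beta
      by (intro continuous_intros continuous_on_matrix_mult)
    show "f X \<ge> 0" for X
      unfolding f_def by (intro add_nonneg_nonneg semi_nonneg reg_nonneg)
    show "\<kappa> / 4 > 0"
      using \<open>\<kappa> > 0\<close> by simp
    show "f ((1 / 2) *\<^sub>R (X + Y)) \<le> (f X + f Y) / 2 - \<kappa> / 4 * (norm (X - Y))\<^sup>2" for X Y
    proof -
      \<comment> \<open>The shift by \<open>B\<close> makes the residual term inhomogeneous in
        \<open>X\<close>. The law is therefore applied to the seminorm itself at the shifted
        matrices, and its defect is simply dropped.\<close>
      have "parallelogram_law (matrix_seminorm_sq P :: real^'r^'l \<Rightarrow> real)"
        unfolding matrix_seminorm_sq_def[abs_def] split_beta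
        by (intro parallelogram_law_sum parallelogram_law_linear_sq) (simp add: linear_iff)
      then have "matrix_seminorm_sq P ((1 / 2) *\<^sub>R (M + M'))
        \<le> (matrix_seminorm_sq P M + matrix_seminorm_sq P M') / 2" for M M' :: "real^'r^'l"
      proof -
        have "matrix_seminorm_sq P ((1 / 2) *\<^sub>R (M + M'))
          = (matrix_seminorm_sq P M + matrix_seminorm_sq P M') / 2 - matrix_seminorm_sq P (M - M') / 4"
          using \<open>parallelogram_law (matrix_seminorm_sq P)\<close> unfolding parallelogram_law_def by blast
        then show ?thesis
          using semi_nonneg[of "M - M'"] by linarith
      qed
      moreover have "L ** ((1 / 2) *\<^sub>R (X + Y)) ** R - B = (1 / 2) *\<^sub>R ((L ** X ** R - B) + (L ** Y ** R - B))"
        unfolding linear_scale[OF linear_matrix_sandwich] linear_add[OF linear_matrix_sandwich]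
        by (simp add: vec_eq_iff field_simps)
      ultimately have "matrix_seminorm_sq P (L ** ((1 / 2) *\<^sub>R (X + Y)) ** R - B)
        \<le> (matrix_seminorm_sq P (L ** X ** R - B) + matrix_seminorm_sq P (L ** Y ** R - B)) / 2"
        by (simp only:)
      \<comment> \<open>Here the defect is kept: by \<open>lower\<close>,
        \<open>?reg (X - Y) / 4\<close> dominates
        \<open>\<kappa> / 4 * (norm (X - Y))\<^sup>2\<close>.\<close>
      moreover have "?reg ((1 / 2) *\<^sub>R (X + Y)) = (?reg X + ?reg Y) / 2 - ?reg (X - Y) / 4"
        using parallelogram_law_regularizer[OF xs] unfolding parallelogram_law_def by blast
      ultimately show ?thesis
        using lower[of "X - Y"] unfolding f_def times_divide_eq_left by argo
    qed
  qed
  then show ?thesis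
    unfolding f_def by (rule ex1_is_arg_min_tiebreakI)
qed

section \<open>Slicewise description of the minimizer of the variational residual\<close>

theorem theorem5p6:
  fixes \<omega> s\<^sub>1 s\<^sub>2 :: real
    and A B :: "real^'r^'l^'n"
    and S :: "('l \<times> 'n \<times> 'r) set"
    and L :: "real^'g^'l" and \<Gamma> :: "real^'g^'g" and N :: "real^'t^'g^'n"
    and \<Theta> :: "real^'t^'t" and R :: "real^'r^'t"
    and xs :: "'n \<Rightarrow> ('l \<times> 'r) list"
    and D \<zeta>\<^sub>1 \<zeta>\<^sub>2 \<zeta>\<^sub>1\<^sub>2 nL nN nR :: real
  assumes "\<omega> > 0" and "s\<^sub>1 > 0" and "s\<^sub>2 > 0"
    and "A \<noteq> 0"
    and "tt_rank A = (CARD('g), CARD('t))"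
    and "standard_representation A L \<Gamma> N \<Theta> R"
    and "\<forall>j. distinct (xs j) \<and> set (xs j) = slice S j"
    and "nL = real CARD('l) * real CARD('g)"
    and "nN = real CARD('g) * real CARD('n) * real CARD('t)"
    and "nR = real CARD('t) * real CARD('r)"
    and "D = nL + nN + nR"
    and "\<zeta>\<^sub>1 = s\<^sub>1^2 * (nL / (real CARD('g) * (D + 2)))"
    and "\<zeta>\<^sub>2 = s\<^sub>2^2 * (nR / (real CARD('t) * (D + 2)))"
    and "\<zeta>\<^sub>1\<^sub>2 = s\<^sub>1^2 * s\<^sub>2^2 * (nR * nL / (real CARD('g) * real CARD('t) * (D + 2) * (D + 4)))"
  shows "(\<exists>!X. is_arg_min_tiebreak
              (variational_residual \<omega> s\<^sub>1 s\<^sub>2 B S L (\<Gamma> *lc N *rc \<Theta>) R)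
              (\<lambda>X. norm (L *lc X *rc R)) X) \<and>
         (\<forall>Nplus. is_arg_min_tiebreak
              (variational_residual \<omega> s\<^sub>1 s\<^sub>2 B S L (\<Gamma> *lc N *rc \<Theta>) R)
              (\<lambda>X. norm (L *lc X *rc R)) Nplus \<longleftrightarrow>
           (\<forall>j. is_arg_min_tiebreak
              (\<lambda>X. matrix_seminorm_sq (slice S j) (L ** X ** R - B $ j)
                 + regularizer \<omega> \<zeta>\<^sub>1 \<zeta>\<^sub>2 \<zeta>\<^sub>1\<^sub>2 L \<Gamma> \<Theta> R (slice S j) (xs j) X)
              (\<lambda>X. norm (L ** X ** R)) (Nplus $ j)))"
proof -
  define F where "F = variational_residual \<omega> s\<^sub>1 s\<^sub>2 B S L (\<Gamma> *lc N *rc \<Theta>) R"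
  define f where "f = (\<lambda>j X. matrix_seminorm_sq (slice S j) (L ** X ** R - B $ j)
                 + regularizer \<omega> \<zeta>\<^sub>1 \<zeta>\<^sub>2 \<zeta>\<^sub>1\<^sub>2 L \<Gamma> \<Theta> R (slice S j) (xs j) X)"
  have D: "D = real CARD('l) * real CARD('g) + real CARD('g) * real CARD('n) * real CARD('t)
      + real CARD('t) * real CARD('r)"
    using assms by simp
  have "D > 0"
    unfolding D by (intro add_pos_pos mult_pos_pos) auto
  have \<zeta>: "\<zeta>\<^sub>1 = s\<^sub>1\<^sup>2 * (real CARD('l) / (D + 2))" "\<zeta>\<^sub>2 = s\<^sub>2\<^sup>2 * (real CARD('r) / (D + 2))"
      "\<zeta>\<^sub>1\<^sub>2 = s\<^sub>1\<^sup>2 * s\<^sub>2\<^sup>2 * (real CARD('r) * real CARD('l) / ((D + 2) * (D + 4)))"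
    \<comment> \<open>The ranks hidden in \<open>nL\<close> and \<open>nR\<close> cancel against the
      rank factors in the denominators.\<close>
    using assms(8-10,12-14) by (simp_all add: divide_simps)
  then have \<zeta>_pos: "\<zeta>\<^sub>1 \<ge> 0" "\<zeta>\<^sub>2 \<ge> 0" "\<zeta>\<^sub>1\<^sub>2 > 0"
    using \<open>D > 0\<close> assms(2,3) by auto
  have orth: "transpose L ** L = mat 1" "R ** transpose R = mat 1"
    and \<Gamma>: "\<forall>a b. a \<noteq> b \<longrightarrow> \<Gamma> $ a $ b = 0" "\<forall>a. \<Gamma> $ a $ a > 0"
    and \<Theta>: "\<forall>a b. a \<noteq> b \<longrightarrow> \<Theta> $ a $ b = 0" "\<forall>a. \<Theta> $ a $ a > 0"
    using assms(6) by (auto simp: standard_representation_def truncated_svd_def)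
  obtain K C where "K > 0" and F: "F X = K * (\<Sum>j\<in>UNIV. f j (X $ j)) + C" for X
    unfolding F_def f_def
    using variational_residual_eq[OF assms(6,1,7) D \<zeta>, where B = B] by blast
  have norm_eq: "(norm (L *lc X *rc R))\<^sup>2 = (\<Sum>j\<in>UNIV. (norm (L ** X $ j ** R))\<^sup>2)" for X
    unfolding norm_vec_sq[of "L *lc X *rc R"] by (simp add: core_lmult_def core_rmult_def matrix_mul_assoc)
  \<comment> \<open>Only the squared norm is additive over slices, so the tie-break is passed to
    squares and back.\<close>
  have sq_less: "a\<^sup>2 < b\<^sup>2 \<longleftrightarrow> a < b" if "a \<ge> 0" "b \<ge> 0" for a b :: real
    using that by (auto intro: power_strict_mono power2_less_imp_less)
  have tiebreak: "is_arg_min_tiebreak F (\<lambda>X. norm (L *lc X *rc R)) X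
    \<longleftrightarrow> (\<forall>j. is_arg_min_tiebreak (f j) (\<lambda>X. norm (L ** X ** R)) (X $ j))" for X
  proof -
    have "is_arg_min_tiebreak F (\<lambda>X. norm (L *lc X *rc R)) X
      \<longleftrightarrow> (\<forall>j. is_arg_min_tiebreak (f j) (\<lambda>X. (norm (L ** X ** R))\<^sup>2) (X $ j))"
    proof (rule is_arg_min_tiebreak_sum)
      show "F X < F Y \<longleftrightarrow> (\<Sum>j\<in>UNIV. f j (X $ j)) < (\<Sum>j\<in>UNIV. f j (Y $ j))" for X Y
        using \<open>K > 0\<close> by (simp add: F)
      show "norm (L *lc X *rc R) < norm (L *lc Y *rc R)
        \<longleftrightarrow> (\<Sum>j\<in>UNIV. (norm (L ** X $ j ** R))\<^sup>2) < (\<Sum>j\<in>UNIV. (norm (L ** Y $ j ** R))\<^sup>2)" for X Y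
        unfolding norm_eq[symmetric] by (rule sq_less[symmetric]) simp_all
    qed
    moreover have "is_arg_min_tiebreak (f j) (\<lambda>X. (norm (L ** X ** R))\<^sup>2)
      = is_arg_min_tiebreak (f j) (\<lambda>X. norm (L ** X ** R))" for j
      unfolding is_arg_min_tiebreak_def
      by (intro ext fun_cong[OF is_arg_min_cong_less]) (simp add: sq_less)
    ultimately show ?thesis
      by simp
  qed
  have ex1: "\<exists>!X. is_arg_min_tiebreak (f j) (\<lambda>X. norm (L ** X ** R)) X" for j
    unfolding f_def
    by (rule ex1_slice_minimizer[OF orth matrix_inv_diagonal(2)[OF \<Gamma>] matrix_inv_diagonal(3)[OF \<Theta>] _ _ assms(1) \<zeta>_pos])
       (use assms(7) in auto)
  \<comment> \<open>The unique slice minimizers are assembled into a core; by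
    \<open>tiebreak\<close> it is the only candidate for the full problem.\<close>
  define Y where "Y j = (THE X. is_arg_min_tiebreak (f j) (\<lambda>X. norm (L ** X ** R)) X)" for j
  have Y: "is_arg_min_tiebreak (f j) (\<lambda>X. norm (L ** X ** R)) X \<longleftrightarrow> X = Y j" for j X
    using theI'[OF ex1[of j]] ex1[of j] unfolding Y_def[symmetric] by blast
  have "\<exists>!X. is_arg_min_tiebreak F (\<lambda>X. norm (L *lc X *rc R)) X"
    by (rule ex1I[of _ "\<chi> j. Y j"]) (auto simp: tiebreak Y vec_eq_iff)
  then show ?thesis
    using tiebreak unfolding F_def f_def by blast
qed

end
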